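(* Let $\mathbb M\to\mathbb E\to\mathbb H$ be a regular split extension of partial groups. Then a regular section $\sigma\colon\mathbb H\to\mathbb E$ determines a homomorphism of partial groups $\rho\colon\mathbb H\to B\mathrm{Aut}(\mathbb M)$ and an isomorphism of regular split extensions, that is, an isomorphism $\varphi\colon\mathbb M\rtimes_\rho\mathbb H\to\mathbb E$ compatible with the inclusions of $\mathbb M$ (over $\mathrm{Id}_{\mathbb M}$), with the projections to $\mathbb H$ (over $\mathrm{Id}_{\mathbb H}$), and with the sections ($\varphi\circ\sigma_0=\sigma$), where $\sigma_0\colon\mathbb H\to\mathbb M\rtimes_\rho\mathbb H$ is the canonical section of the semidirect product.
   Context: Partial groups. A partial monoid is a nonempty simplicial set $\mathbb M$ with exactly one vertex $v$ such that for all $n\ge1$ the spine map $\mathbb M_n\to(\mathbb M_1)^n$, whose $i$-th component is induced by the map $[1]\to[n]$ with image $\{i-1,i\}$, is injective. The $n$-simplex with spine $(x_1,\dots,x_n)$ is written $[x_1|\dots|x_n]$. $\Pi\colon\mathbb M_n\to\mathbb M_1$ is induced by $[1]\to[n]$ with image $\{0,n\}$; $x_1\cdots x_n=\Pi[x_1|\dots|x_n]$, $1=s_0(v)$. A partial group is a partial monoid with an inversion: a simplicial map $\nu\colon\mathbb M\to\mathbb M^{\mathrm{op}}$ with $\nu^{-1}=\nu^{\mathrm{op}}$ such that for every $u\in\mathbb M_n$, $n\ge1$, there is a simplex $[\nu(u)|u]\in\mathbb M_{2n}$ with $\Pi[\nu(u)|u]=1$; $u^{-1}=\nu(u)$. Homomorphisms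 are simplicial maps. For a group $G$, $BG$ is the bar construction, a partial group. With $\iota_1\in\Delta[1]_1$ the nondegenerate edge, $v_0=d_1\iota_1$, $v_1=d_0\iota_1$, a homotopy from $g$ to $f$ is $F\colon Y\times\Delta[1]\to X$ with $f=F\circ(\mathrm{Id}\times v_0)$, $g=F\circ(\mathrm{Id}\times v_1)$. Write $f\xleftarrow{\eta}g$ if there is such an $F$ with $F(1,\iota_1)=\eta$. A fibre bundle with fibre $F$ is a surjective simplicial map $E\to B$ whose pullback along each simplex $\Delta[n]\to B$ is isomorphic over $\Delta[n]$ to $F\times\Delta[n]$. An extension $\mathbb M\xrightarrow{\iota}\mathbb E\xrightarrow{\tau}\mathbb H$ of partial groups is a fibre bundle $\tau$ with fibre $\mathbb M$, $\iota$ identifying $\mathbb M$ with the fibre over the vertex of $\mathbb H$; $\mathbb E$ is then a partial group. $\mathbb N_{\mathbb E}(\mathbb M)$ is the set of simplices $[z_1|\dots|z_n]\in\mathbb E$ such that for each $i$ there is an automorphism $c_{z_i}$ of $\mathbb M$ with $\iota\circ c_{z_i}\xleftarrow{z_i}\iota$. A section $\sigma$ of $\tau$ is regular if $\sigma(\mathbb H)\subseteq\mathbb N_{\mathbb E}(\mathbb M)$; the extension is regular split if it admits a regular section. Semidirect product: for a homomorphism $\rho\colon\mathbb H\to B\mathrm{Aut}(\mathbb M)$, with ${}^gx=\rho(g)(x)$, $\mathbb M\rtimes_\rho\mathbb H$ is the partial group with $1$-simplices $\mathbb M_1\times\mathbb H_1$ and with $n$-simplices $[(x_1,g_1)|\dots|(x_n,g_n)]$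 such that $[g_1|\dots|g_n]\in\mathbb H_n$ and $[x_1|{}^{g_1}x_2|{}^{g_1g_2}x_3|\dots|{}^{g_1\cdots g_{n-1}}x_n]\in\mathbb M_n$, with multiplication $(x_1,g_1)\cdot(x_2,g_2)=(x_1\cdot{}^{g_1}x_2,g_1\cdot g_2)$. It is an extension of $\mathbb H$ by $\mathbb M$ with inclusion $x\mapsto(x,1)$ and projection $[(x_1,g_1)|\dots|(x_n,g_n)]\mapsto[g_1|\dots|g_n]$, and canonical (regular) section $\sigma_0[g_1|\dots|g_n]=[(1,g_1)|\dots|(1,g_n)]$. *)

theory Defs
  imports "HOL-Algebra.Group"
begin

section \<open>Simplicial sets\<close>

text \<open>Morphisms \<open>[m] \<rightarrow> [n]\<close> of the simplex category are extensional monotone functions on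
  \<open>{0,\<dots>,m}\<close>, so that equal morphisms are equal as HOL functions.\<close>

definition delta :: "nat \<Rightarrow> nat \<Rightarrow> (nat \<Rightarrow> nat) set" where
  "delta m n = {\<theta> \<in> {..m} \<rightarrow>\<^sub>E {..n}. mono_on {..m} \<theta>}"

definition delta_id :: "nat \<Rightarrow> nat \<Rightarrow> nat" where
  "delta_id n = (\<lambda>k\<in>{..n}. k)"

definition delta_const :: "nat \<Rightarrow> nat \<Rightarrow> nat \<Rightarrow> nat" where
  "delta_const m j = (\<lambda>k\<in>{..m}. j)"

text \<open>The map out of \<open>[1]\<close> with \<open>0 \<mapsto> i\<close> and \<open>1 \<mapsto> j\<close>.\<close>

definition delta_edge :: "nat \<Rightarrow> nat \<Rightarrow> nat \<Rightarrow> nat" where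
  "delta_edge i j = (\<lambda>k\<in>{..1}. if k = 0 then i else j)"

text \<open>For \<open>\<theta> : [m] \<rightarrow> [n]\<close>, the map \<open>sact X m n \<theta>\<close> is the induced \<open>X\<^sub>n \<rightarrow> X\<^sub>m\<close>.\<close>

record 'a sset =
  simplices :: "nat \<Rightarrow> 'a set"
  sact :: "nat \<Rightarrow> nat \<Rightarrow> (nat \<Rightarrow> nat) \<Rightarrow> 'a \<Rightarrow> 'a"

definition simplicial_set :: "'a sset \<Rightarrow> bool" where
  "simplicial_set X \<longleftrightarrow>
     (\<forall>m n. \<forall>\<theta>\<in>delta m n. \<forall>x\<in>simplices X n. sact X m n \<theta> x \<in> simplices X m) \<and>
     (\<forall>n. \<forall>x\<in>simplices X n. sact X n n (delta_id n) x = x) \<and>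
     (\<forall>l m n. \<forall>\<alpha>\<in>delta l m. \<forall>\<theta>\<in>delta m n. \<forall>x\<in>simplices X n.
        sact X l n (compose {..l} \<theta> \<alpha>) x = sact X l m \<alpha> (sact X m n \<theta> x))"

text \<open>Simplicial maps are extensional in each degree, so that equality in HOL is equality of
  simplicial maps.\<close>

definition sset_hom :: "'a sset \<Rightarrow> 'b sset \<Rightarrow> (nat \<Rightarrow> 'a \<Rightarrow> 'b) \<Rightarrow> bool" where
  "sset_hom X Y f \<longleftrightarrow>
     simplicial_set X \<and> simplicial_set Y \<and>
     (\<forall>n. f n \<in> simplices X n \<rightarrow>\<^sub>E simplices Y n) \<and>
     (\<forall>m n. \<forall>\<theta>\<in>delta m n. \<forall>x\<in>simplices X n.
        f m (sact X m n \<theta> x) = sact Y m n \<theta> (f n x))"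

definition sset_iso :: "'a sset \<Rightarrow> 'b sset \<Rightarrow> (nat \<Rightarrow> 'a \<Rightarrow> 'b) \<Rightarrow> bool" where
  "sset_iso X Y f \<longleftrightarrow>
     sset_hom X Y f \<and> (\<forall>n. bij_betw (f n) (simplices X n) (simplices Y n))"

definition sset_id :: "'a sset \<Rightarrow> nat \<Rightarrow> 'a \<Rightarrow> 'a" where
  "sset_id X = (\<lambda>n. \<lambda>x\<in>simplices X n. x)"

text \<open>\<open>sset_comp X g f\<close> is the composite \<open>g \<circ> f\<close>, where \<open>X\<close> is the domain of \<open>f\<close>.\<close>

definition sset_comp ::
  "'a sset \<Rightarrow> (nat \<Rightarrow> 'b \<Rightarrow> 'c) \<Rightarrow> (nat \<Rightarrow> 'a \<Rightarrow> 'b) \<Rightarrow> nat \<Rightarrow> 'a \<Rightarrow> 'c" where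
  "sset_comp X g f = (\<lambda>n. compose (simplices X n) (g n) (f n))"

definition std_simplex :: "nat \<Rightarrow> (nat \<Rightarrow> nat) sset" where
  "std_simplex n = \<lparr>simplices = (\<lambda>k. delta k n), sact = (\<lambda>k l \<theta> \<alpha>. compose {..k} \<alpha> \<theta>)\<rparr>"

definition sset_prod :: "'a sset \<Rightarrow> 'b sset \<Rightarrow> ('a \<times> 'b) sset" where
  "sset_prod X Y =
     \<lparr>simplices = (\<lambda>n. simplices X n \<times> simplices Y n),
      sact = (\<lambda>m n \<theta> (x, y). (sact X m n \<theta> x, sact Y m n \<theta> y))\<rparr>"

definition sset_op :: "'a sset \<Rightarrow> 'a sset" where
  "sset_op X =
     \<lparr>simplices = simplices X,
      sact = (\<lambda>m n \<theta>. sact X m n (\<lambda>k\<in>{..m}. n - \<theta> (m - k)))\<rparr>"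

definition sset_pullback ::
  "'a sset \<Rightarrow> 'b sset \<Rightarrow> (nat \<Rightarrow> 'a \<Rightarrow> 'c) \<Rightarrow> (nat \<Rightarrow> 'b \<Rightarrow> 'c) \<Rightarrow> ('a \<times> 'b) sset" where
  "sset_pullback X Y f g =
     \<lparr>simplices = (\<lambda>n. {(x, y). x \<in> simplices X n \<and> y \<in> simplices Y n \<and> f n x = g n y}),
      sact = sact (sset_prod X Y)\<rparr>"

text \<open>The fibre of \<open>f : X \<rightarrow> Y\<close> over a vertex \<open>v\<close> of \<open>Y\<close>: the simplices of \<open>X\<close> lying over
  the degeneracies of \<open>v\<close>.\<close>

definition sset_fibre :: "'a sset \<Rightarrow> 'b sset \<Rightarrow> (nat \<Rightarrow> 'a \<Rightarrow> 'b) \<Rightarrow> 'b \<Rightarrow> 'a sset" where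
  "sset_fibre X Y f v =
     \<lparr>simplices = (\<lambda>n. {x \<in> simplices X n. f n x = sact Y n 0 (delta_const n 0) v}),
      sact = sact X\<rparr>"

section \<open>Partial groups\<close>

definition spine :: "'a sset \<Rightarrow> nat \<Rightarrow> 'a \<Rightarrow> 'a list" where
  "spine X n x = map (\<lambda>i. sact X 1 n (delta_edge i (i + 1)) x) [0..<n]"

definition partial_monoid :: "'a sset \<Rightarrow> bool" where
  "partial_monoid X \<longleftrightarrow>
     simplicial_set X \<and> (\<exists>!v. v \<in> simplices X 0) \<and>
     (\<forall>n\<ge>1. inj_on (spine X n) (simplices X n))"

definition vertex :: "'a sset \<Rightarrow> 'a" where
  "vertex X = (THE v. v \<in> simplices X 0)"

definition unit :: "'a sset \<Rightarrow> 'a" where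
  "unit X = sact X 1 0 (delta_const 1 0) (vertex X)"

definition Pi_map :: "'a sset \<Rightarrow> nat \<Rightarrow> 'a \<Rightarrow> 'a" where
  "Pi_map X n x = sact X 1 n (delta_edge 0 n) x"

definition words :: "'a sset \<Rightarrow> nat \<Rightarrow> 'a list set" where
  "words X n = spine X n ` simplices X n"

text \<open>The simplex \<open>[x\<^sub>1|\<dots>|x\<^sub>n]\<close>, meaningful for lists in \<open>words X n\<close>.\<close>

definition simplex_of :: "'a sset \<Rightarrow> 'a list \<Rightarrow> 'a" where
  "simplex_of X xs =
     (THE u. u \<in> simplices X (length xs) \<and> spine X (length xs) u = xs)"

text \<open>The product \<open>x\<^sub>1\<cdots>x\<^sub>n\<close>; the empty product is \<open>unit X\<close>, since \<open>delta_edge 0 0\<close> is the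
  map \<open>[1] \<rightarrow> [0]\<close>.\<close>

definition pprod :: "'a sset \<Rightarrow> 'a list \<Rightarrow> 'a" where
  "pprod X xs = Pi_map X (length xs) (simplex_of X xs)"

text \<open>\<open>sset_op (sset_op X)\<close> is \<open>X\<close>, and the opposite of \<open>\<nu>\<close> has the same underlying
  functions as \<open>\<nu>\<close>; being inverse to its opposite thus means that \<open>\<nu>\<close> is involutive.\<close>

definition inversion :: "'a sset \<Rightarrow> (nat \<Rightarrow> 'a \<Rightarrow> 'a) \<Rightarrow> bool" where
  "inversion X \<nu> \<longleftrightarrow>
     sset_hom X (sset_op X) \<nu> \<and>
     (\<forall>n. \<forall>u\<in>simplices X n. \<nu> n (\<nu> n u) = u) \<and>
     (\<forall>n\<ge>1. \<forall>u\<in>simplices X n. \<exists>w\<in>simplices X (2 * n).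
        spine X (2 * n) w = spine X n (\<nu> n u) @ spine X n u \<and> Pi_map X (2 * n) w = unit X)"

definition partial_group :: "'a sset \<Rightarrow> bool" where
  "partial_group X \<longleftrightarrow> partial_monoid X \<and> (\<exists>\<nu>. inversion X \<nu>)"

text \<open>If simplices are identified with their spines, then the \<open>i\<close>-th entry of
  \<open>\<theta>\<^sup>*[x\<^sub>1|\<dots>|x\<^sub>n]\<close> is the product \<open>x\<^sub>j\<cdots>x\<^sub>k\<close> with \<open>j = \<theta> (i - 1) + 1\<close> and \<open>k = \<theta> i\<close>.\<close>

definition bar_act ::
  "('a \<Rightarrow> 'a \<Rightarrow> 'a) \<Rightarrow> 'a \<Rightarrow> nat \<Rightarrow> nat \<Rightarrow> (nat \<Rightarrow> nat) \<Rightarrow> 'a list \<Rightarrow> 'a list" where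
  "bar_act mul e m n \<theta> xs =
     map (\<lambda>i. foldl mul e (take (\<theta> (i + 1) - \<theta> i) (drop (\<theta> i) xs))) [0..<m]"

definition bar :: "('a, 'b) monoid_scheme \<Rightarrow> 'a list sset" where
  "bar G =
     \<lparr>simplices = (\<lambda>n. {gs \<in> lists (carrier G). length gs = n}),
      sact = bar_act (mult G) (one G)\<rparr>"

definition aut_group :: "'a sset \<Rightarrow> (nat \<Rightarrow> 'a \<Rightarrow> 'a) monoid" where
  "aut_group X = \<lparr>carrier = {\<alpha>. sset_iso X X \<alpha>}, mult = sset_comp X, one = sset_id X\<rparr>"

section \<open>Extensions\<close>

text \<open>\<open>homotopic_via Y X f \<eta> g\<close> renders \<open>f \<leftarrow> g\<close> with label \<open>\<eta>\<close>. The degeneracies of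
  \<open>v\<^sub>0 = d\<^sub>1 \<iota>\<^sub>1\<close> and of \<open>v\<^sub>1 = d\<^sub>0 \<iota>\<^sub>1\<close> in degree \<open>n\<close> are the constant maps
  \<open>[n] \<rightarrow> [1]\<close> with value \<open>0\<close> and \<open>1\<close>, and \<open>\<iota>\<^sub>1\<close> is \<open>delta_id 1\<close>.\<close>

definition homotopic_via ::
  "'a sset \<Rightarrow> 'b sset \<Rightarrow> (nat \<Rightarrow> 'a \<Rightarrow> 'b) \<Rightarrow> 'b \<Rightarrow> (nat \<Rightarrow> 'a \<Rightarrow> 'b) \<Rightarrow> bool" where
  "homotopic_via Y X f \<eta> g \<longleftrightarrow>
     (\<exists>F. sset_hom (sset_prod Y (std_simplex 1)) X F \<and>
        f = (\<lambda>n. \<lambda>y\<in>simplices Y n. F n (y, delta_const n 0)) \<and>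
        g = (\<lambda>n. \<lambda>y\<in>simplices Y n. F n (y, delta_const n 1)) \<and>
        F 1 (unit Y, delta_id 1) = \<eta>)"

definition fibre_bundle ::
  "'f sset \<Rightarrow> 'e sset \<Rightarrow> 'b sset \<Rightarrow> (nat \<Rightarrow> 'e \<Rightarrow> 'b) \<Rightarrow> bool" where
  "fibre_bundle F E B \<tau> \<longleftrightarrow>
     sset_hom E B \<tau> \<and> (\<forall>n. \<tau> n ` simplices E n = simplices B n) \<and>
     (\<forall>n b. sset_hom (std_simplex n) B b \<longrightarrow>
        (\<exists>\<psi>. sset_iso (sset_pullback E (std_simplex n) \<tau> b) (sset_prod F (std_simplex n)) \<psi> \<and>
             (\<forall>k. \<forall>p\<in>simplices (sset_pullback E (std_simplex n) \<tau> b) k.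
                snd (\<psi> k p) = snd p)))"

text \<open>That \<open>E\<close> is a partial group is a consequence and not required.\<close>

definition extension ::
  "'a sset \<Rightarrow> 'b sset \<Rightarrow> 'c sset \<Rightarrow> (nat \<Rightarrow> 'a \<Rightarrow> 'b) \<Rightarrow> (nat \<Rightarrow> 'b \<Rightarrow> 'c) \<Rightarrow> bool" where
  "extension M E H \<iota> \<tau> \<longleftrightarrow>
     partial_group M \<and> partial_group H \<and> fibre_bundle M E H \<tau> \<and>
     sset_iso M (sset_fibre E H \<tau> (vertex H)) \<iota>"

definition ext_normalizer ::
  "'a sset \<Rightarrow> 'b sset \<Rightarrow> (nat \<Rightarrow> 'a \<Rightarrow> 'b) \<Rightarrow> nat \<Rightarrow> 'b set" where
  "ext_normalizer M E \<iota> n =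
     {u \<in> simplices E n. \<forall>z\<in>set (spine E n u).
        \<exists>c\<in>carrier (aut_group M). homotopic_via M E (sset_comp M \<iota> c) z \<iota>}"

definition regular_section ::
  "'a sset \<Rightarrow> 'b sset \<Rightarrow> 'c sset \<Rightarrow> (nat \<Rightarrow> 'a \<Rightarrow> 'b) \<Rightarrow> (nat \<Rightarrow> 'b \<Rightarrow> 'c) \<Rightarrow>
     (nat \<Rightarrow> 'c \<Rightarrow> 'b) \<Rightarrow> bool" where
  "regular_section M E H \<iota> \<tau> \<sigma> \<longleftrightarrow>
     sset_hom H E \<sigma> \<and> sset_comp H \<tau> \<sigma> = sset_id H \<and>
     (\<forall>n. \<sigma> n ` simplices H n \<subseteq> ext_normalizer M E \<iota> n)"

section \<open>Semidirect products\<close>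

text \<open>\<open>\<^sup>gx\<close> for 1-simplices \<open>g\<close> and \<open>x\<close>; a 1-simplex of the bar construction is a list
  of length 1.\<close>

definition sd_action ::
  "(nat \<Rightarrow> 'c \<Rightarrow> (nat \<Rightarrow> 'a \<Rightarrow> 'a) list) \<Rightarrow> 'c \<Rightarrow> 'a \<Rightarrow> 'a" where
  "sd_action \<rho> g x = hd (\<rho> 1 g) 1 x"

definition sd_mult ::
  "'a sset \<Rightarrow> 'c sset \<Rightarrow> (nat \<Rightarrow> 'c \<Rightarrow> (nat \<Rightarrow> 'a \<Rightarrow> 'a) list) \<Rightarrow>
     'a \<times> 'c \<Rightarrow> 'a \<times> 'c \<Rightarrow> 'a \<times> 'c" where
  "sd_mult M H \<rho> = (\<lambda>(x, g) (y, h). (pprod M [x, sd_action \<rho> g y], pprod H [g, h]))"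

text \<open>The list whose \<open>i\<close>-th entry, counting from 0, is \<open>x\<^sub>i\<^sub>+\<^sub>1\<close> acted on by
  \<open>g\<^sub>1\<cdots>g\<^sub>i\<close>; the empty product acts trivially when \<open>\<rho>\<close> is a homomorphism.\<close>

definition sd_twist ::
  "'c sset \<Rightarrow> (nat \<Rightarrow> 'c \<Rightarrow> (nat \<Rightarrow> 'a \<Rightarrow> 'a) list) \<Rightarrow> ('a \<times> 'c) list \<Rightarrow> 'a list" where
  "sd_twist H \<rho> zs =
     map (\<lambda>i. sd_action \<rho> (pprod H (take i (map snd zs))) (fst (zs ! i))) [0..<length zs]"

definition semidirect ::
  "'a sset \<Rightarrow> 'c sset \<Rightarrow> (nat \<Rightarrow> 'c \<Rightarrow> (nat \<Rightarrow> 'a \<Rightarrow> 'a) list) \<Rightarrow> ('a \<times> 'c) list sset" where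
  "semidirect M H \<rho> =
     \<lparr>simplices = (\<lambda>n. {zs \<in> lists (simplices M 1 \<times> simplices H 1).
        length zs = n \<and> map snd zs \<in> words H n \<and> sd_twist H \<rho> zs \<in> words M n}),
      sact = bar_act (sd_mult M H \<rho>) (unit M, unit H)\<rparr>"

definition sd_incl :: "'a sset \<Rightarrow> 'c sset \<Rightarrow> nat \<Rightarrow> 'a \<Rightarrow> ('a \<times> 'c) list" where
  "sd_incl M H = (\<lambda>n. \<lambda>u\<in>simplices M n. map (\<lambda>x. (x, unit H)) (spine M n u))"

definition sd_proj ::
  "'a sset \<Rightarrow> 'c sset \<Rightarrow> (nat \<Rightarrow> 'c \<Rightarrow> (nat \<Rightarrow> 'a \<Rightarrow> 'a) list) \<Rightarrow>
     nat \<Rightarrow> ('a \<times> 'c) list \<Rightarrow> 'c" where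
  "sd_proj M H \<rho> =
     (\<lambda>n. \<lambda>zs\<in>simplices (semidirect M H \<rho>) n. simplex_of H (map snd zs))"

definition sd_sect :: "'a sset \<Rightarrow> 'c sset \<Rightarrow> nat \<Rightarrow> 'c \<Rightarrow> ('a \<times> 'c) list" where
  "sd_sect M H = (\<lambda>n. \<lambda>u\<in>simplices H n. map (\<lambda>g. (unit M, g)) (spine H n u))"

end

theory Submission
  imports Defs
begin

text \<open>Write \<open>c\<^sub>g\<close> for the automorphism given by regularity at \<open>\<sigma> g\<close>, so that
  \<open>\<sigma>(g) \<cdot> \<iota>(x) = \<iota>(c\<^sub>g x) \<cdot> \<sigma>(g)\<close>; then \<open>\<rho> g = c\<^sub>g\<close> and \<open>\<phi>(x, g) = \<iota>(x) \<cdot> \<sigma>(g)\<close> are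
  forced. That \<open>\<phi>\<close> is bijective in degree \<open>n\<close> is a statement about the part of \<open>E\<close> over one
  simplex \<open>b = [g\<^sub>1|\<dots>|g\<^sub>n]\<close> of \<open>H\<close>. The homotopies over the edges of \<open>b\<close> are isomorphisms onto the
  pullbacks, since homotopies of partial groups can be reversed, and they are glued, inside any
  trivialization over \<open>b\<close>, to one trivialization \<open>G : M \<times> \<Delta>[n] \<rightarrow> E\<close> over \<open>b\<close> that sends the base
  point to \<open>\<sigma> b\<close>, restricts to \<open>\<iota>\<close> over the vertex 0, and restricts to an automorphism \<open>c\<^sub>i\<close> of
  \<open>M\<close> followed by \<open>\<iota>\<close> over the vertex \<open>i\<close>. A simplex over \<open>b\<close> is thus \<open>G u\<close> for a unique
  \<open>u\<close> in \<open>M\<^sub>n\<close>. Its spine consists of the elements \<open>\<phi>(x\<^sub>i, g\<^sub>i)\<close> with \<open>x\<^sub>i = c\<^sub>i\<^sub>-\<^sub>1 u\<^sub>i\<close>, and \<open>c\<^sub>i\<^sub>-\<^sub>1\<close> is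
  inverse to the action of \<open>g\<^sub>1\<cdots>g\<^sub>i\<^sub>-\<^sub>1\<close>, so \<open>u\<close> is the twisted list of the \<open>x\<^sub>i\<close>.\<close>

section \<open>Simplicial sets and partial monoids\<close>

declare One_nat_def [simp del]

lemma Suc_0_eq_1 [simp]: "Suc 0 = 1"
  by (simp add: One_nat_def)

section \<open>Maps of the simplex category\<close>

lemma deltaI:
  assumes "\<And>k. k \<le> m \<Longrightarrow> f k \<le> n" and "\<And>i j. i \<le> j \<Longrightarrow> j \<le> m \<Longrightarrow> f i \<le> f j"
  shows "(\<lambda>k\<in>{..m}. f k) \<in> delta m n"
  using assms by (auto simp: delta_def mono_on_def)

lemma delta_le: "\<theta> \<in> delta m n \<Longrightarrow> i \<le> m \<Longrightarrow> \<theta> i \<le> n"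
  by (auto simp: delta_def PiE_def Pi_def)

lemma delta_mono: "\<theta> \<in> delta m n \<Longrightarrow> i \<le> j \<Longrightarrow> j \<le> m \<Longrightarrow> \<theta> i \<le> \<theta> j"
  by (auto simp: delta_def mono_on_def)

lemma delta_eqI:
  assumes "\<theta> \<in> delta m n" "\<theta>' \<in> delta m n'" "\<And>i. i \<le> m \<Longrightarrow> \<theta> i = \<theta>' i"
  shows "\<theta> = \<theta>'"
proof -
  have "\<theta> \<in> extensional {..m}" "\<theta>' \<in> extensional {..m}"
    using assms by (auto simp: delta_def PiE_def)
  then show ?thesis
    by (rule extensionalityI) (use assms(3) in auto)
qed

lemma delta_compose [simp]:
  "\<alpha> \<in> delta l m \<Longrightarrow> \<theta> \<in> delta m n \<Longrightarrow> compose {..l} \<theta> \<alpha> \<in> delta l n"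
  unfolding compose_def by (rule deltaI) (auto intro: delta_le delta_mono)

lemma delta_id_in [simp]: "delta_id n \<in> delta n n"
  unfolding delta_id_def by (rule deltaI) auto

lemma delta_const_in [simp]: "j \<le> n \<Longrightarrow> delta_const m j \<in> delta m n"
  unfolding delta_const_def by (rule deltaI) auto

lemma delta_edge_in [simp]: "i \<le> j \<Longrightarrow> j \<le> n \<Longrightarrow> delta_edge i j \<in> delta 1 n"
  unfolding delta_edge_def by (rule deltaI) auto

lemma delta_id_apply [simp]: "i \<le> n \<Longrightarrow> delta_id n i = i"
  by (simp add: delta_id_def)

lemma delta_const_apply [simp]: "i \<le> m \<Longrightarrow> delta_const m j i = j"
  by (simp add: delta_const_def)

lemma delta_edge_apply [simp]: "delta_edge i j 0 = i" "delta_edge i j 1 = j"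
  by (simp_all add: delta_edge_def)

definition delta_tri :: "nat \<Rightarrow> nat \<Rightarrow> nat \<Rightarrow> nat \<Rightarrow> nat" where
  "delta_tri i j k = (\<lambda>l\<in>{..2}. if l = 0 then i else if l = 1 then j else k)"

lemma delta_tri_in [simp]: "i \<le> j \<Longrightarrow> j \<le> k \<Longrightarrow> k \<le> n \<Longrightarrow> delta_tri i j k \<in> delta 2 n"
  unfolding delta_tri_def by (rule deltaI) auto

lemma delta_tri_apply [simp]:
  "delta_tri i j k 0 = i" "delta_tri i j k 1 = j"
  "delta_tri i j k 2 = k"
  by (simp_all add: delta_tri_def)

lemma compose_apply: "i \<le> l \<Longrightarrow> compose {..l::nat} f g i = f (g i)"
  by (simp add: compose_def)

lemma compose_delta_id_left [simp]: "\<alpha> \<in> delta l m \<Longrightarrow> compose {..l} (delta_id m) \<alpha> = \<alpha>"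
  by (rule delta_eqI[of _ l m _ m]) (auto simp: compose_apply delta_le)

lemma compose_delta_id_right [simp]: "\<theta> \<in> delta m n \<Longrightarrow> compose {..m} \<theta> (delta_id m) = \<theta>"
  by (rule delta_eqI[of _ m n _ n]) (simp_all add: compose_apply delta_compose[OF delta_id_in])

lemma compose_delta_const_left [simp]:
  "\<alpha> \<in> delta l m \<Longrightarrow> compose {..l} (delta_const m j) \<alpha> = delta_const l j"
  by (auto simp: compose_def delta_const_def fun_eq_iff delta_le)

lemma compose_delta_const_right [simp]:
  "compose {..l} \<theta> (delta_const l j) = delta_const l (\<theta> j)"
  by (auto simp: compose_def delta_const_def fun_eq_iff)

lemma compose_delta_edge [simp]:
  "compose {..1} \<theta> (delta_edge i j) = delta_edge (\<theta> i) (\<theta> j)"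
  by (auto simp: compose_def delta_edge_def fun_eq_iff)

lemma compose_delta_assoc:
  "\<alpha> \<in> delta k l \<Longrightarrow> compose {..k} (compose {..l} \<gamma> \<beta>) \<alpha> = compose {..k} \<gamma> (compose {..k} \<beta> \<alpha>)"
  by (auto simp: compose_def fun_eq_iff delta_le)

lemma delta_edge_same [simp]: "delta_edge i i = delta_const 1 i"
  by (auto simp: delta_edge_def delta_const_def fun_eq_iff)

lemma delta_id_1: "delta_id 1 = delta_edge 0 1"
  by (auto simp: delta_edge_def delta_id_def fun_eq_iff)

section \<open>Edges and triangles of a simplex\<close>

abbreviation edge :: "'a sset \<Rightarrow> nat \<Rightarrow> nat \<Rightarrow> nat \<Rightarrow> 'a \<Rightarrow> 'a" where
  "edge X n i j \<equiv> sact X 1 n (delta_edge i j)"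

lemma sact_in [simp]:
  "simplicial_set X \<Longrightarrow> \<theta> \<in> delta m n \<Longrightarrow> x \<in> simplices X n \<Longrightarrow> sact X m n \<theta> x \<in> simplices X m"
  unfolding simplicial_set_def by blast

lemma sact_id [simp]:
  "simplicial_set X \<Longrightarrow> x \<in> simplices X n \<Longrightarrow> sact X n n (delta_id n) x = x"
  unfolding simplicial_set_def by blast

lemma sact_sact:
  "simplicial_set X \<Longrightarrow> \<alpha> \<in> delta l m \<Longrightarrow> \<theta> \<in> delta m n \<Longrightarrow> x \<in> simplices X n \<Longrightarrow>
     sact X l m \<alpha> (sact X m n \<theta> x) = sact X l n (compose {..l} \<theta> \<alpha>) x"
  unfolding simplicial_set_def by auto

lemma edge_sact:
  assumes "simplicial_set X" "\<theta> \<in> delta m n" "x \<in> simplices X n" "i \<le> j" "j \<le> m"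
  shows "edge X m i j (sact X m n \<theta> x) = edge X n (\<theta> i) (\<theta> j) x"
  using sact_sact[OF assms(1) _ assms(2,3), of "delta_edge i j" 1] assms by simp

lemma edge_self [simp]:
  "simplicial_set X \<Longrightarrow> x \<in> simplices X 1 \<Longrightarrow> edge X 1 0 1 x = x"
  using sact_id[of X x 1] delta_id_1 by auto

text \<open>The witness is the face on the vertices \<open>i\<close>, \<open>j\<close>,
  \<open>k\<close>. All products of edges are computed through such triangles; letting two of the
  vertices coincide gives the unit laws.\<close>

lemma edge_triangle:
  assumes "simplicial_set X" "x \<in> simplices X n" "i \<le> j" "j \<le> k" "k \<le> n"
  obtains w where "w \<in> simplices X 2" "edge X 2 0 1 w = edge X n i j x"
    "edge X 2 1 2 w = edge X n j k x" "edge X 2 0 2 w = edge X n i k x"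
proof
  let ?w = "sact X 2 n (delta_tri i j k) x"
  have d: "delta_tri i j k \<in> delta 2 n" using assms by simp
  show "?w \<in> simplices X 2" using assms by simp
  show "edge X 2 0 1 ?w = edge X n i j x" "edge X 2 1 2 ?w = edge X n j k x"
    "edge X 2 0 2 ?w = edge X n i k x"
    using edge_sact[OF assms(1) d assms(2)] by simp_all
qed

lemma length_spine [simp]: "length (spine X n x) = n"
  by (simp add: spine_def)

lemma nth_spine [simp]: "i < n \<Longrightarrow> spine X n x ! i = edge X n i (Suc i) x"
  by (simp add: spine_def Suc_eq_plus1 del: add_Suc_right)

lemma spine_in: "simplicial_set X \<Longrightarrow> x \<in> simplices X n \<Longrightarrow> set (spine X n x) \<subseteq> simplices X 1"
  by (auto simp: spine_def)

lemma spine_1 [simp]: "simplicial_set X \<Longrightarrow> x \<in> simplices X 1 \<Longrightarrow> spine X 1 x = [x]"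
  by (simp add: spine_def upt_rec)

text \<open>The base point in degree \<open>n\<close>, which is \<open>[1|...|1]\<close> in spine
  notation.\<close>

definition degen :: "'a sset \<Rightarrow> nat \<Rightarrow> 'a" where
  "degen X n = sact X n 0 (delta_const n 0) (vertex X)"

lemma unit_degen: "unit X = degen X 1"
  by (simp add: unit_def degen_def)

section \<open>Partial monoids\<close>

context
  fixes X :: "'a sset"
  assumes X: "partial_monoid X"
begin

lemma pm_simplicial: "simplicial_set X"
  using X by (simp add: partial_monoid_def)

lemma pm_vertex: "vertex X \<in> simplices X 0"
  using X unfolding partial_monoid_def vertex_def by (metis theI')

lemma pm_vertex_unique: "v \<in> simplices X 0 \<Longrightarrow> v = vertex X"
  using X pm_vertex unfolding partial_monoid_def by blast

text \<open>For \<open>n \<ge> 1\<close> this is injectivity of the spine. In degree 0 there are no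
  edges to compare, and uniqueness of the vertex takes over.\<close>

lemma pm_eqI:
  assumes "x \<in> simplices X n" "y \<in> simplices X n"
    and "\<And>i. i < n \<Longrightarrow> edge X n i (Suc i) x = edge X n i (Suc i) y"
  shows "x = y"
proof (cases "n = 0")
  case True
  then show ?thesis using pm_vertex_unique assms by metis
next
  case False
  have "spine X n x = spine X n y" using assms(3) by (intro nth_equalityI) auto
  then show ?thesis using X False assms(1,2)
    unfolding partial_monoid_def by (metis One_nat_def Suc_leI inj_onD neq0_conv)
qed

lemma degen_in [simp]: "degen X n \<in> simplices X n"
  unfolding degen_def using pm_vertex pm_simplicial by simp

lemma unit_in [simp]: "unit X \<in> simplices X 1"
  by (simp add: unit_degen)

text \<open>A constant map factors through \<open>[0]\<close>, and there is only one vertex.\<close>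

lemma sact_const: "x \<in> simplices X n \<Longrightarrow> j \<le> n \<Longrightarrow> sact X m n (delta_const m j) x = degen X m"
proof -
  assume a: "x \<in> simplices X n" "j \<le> n"
  have "sact X 0 n (delta_const 0 j) x = vertex X"
    using a pm_simplicial by (intro pm_vertex_unique) simp
  moreover have "compose {..m} (delta_const 0 j) (delta_const m 0) = delta_const m j"
    by simp
  ultimately show ?thesis
    using sact_sact[OF pm_simplicial, of "delta_const m 0" m 0 "delta_const 0 j" n x] a
    unfolding degen_def by simp
qed

lemma edge_const: "x \<in> simplices X n \<Longrightarrow> i \<le> n \<Longrightarrow> sact X 1 n (delta_const 1 i) x = unit X"
  using sact_const unit_degen by metis

lemma sact_degen: "\<theta> \<in> delta m n \<Longrightarrow> sact X m n \<theta> (degen X n) = degen X m"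
  unfolding degen_def
  using sact_sact[OF pm_simplicial, of \<theta> m n "delta_const n 0" 0 "vertex X"] pm_vertex by simp

lemma simplex_of_spine: "x \<in> simplices X n \<Longrightarrow> simplex_of X (spine X n x) = x"
proof -
  assume x: "x \<in> simplices X n"
  show ?thesis unfolding simplex_of_def
  proof (rule the_equality)
    fix u assume u: "u \<in> simplices X (length (spine X n x)) \<and>
      spine X (length (spine X n x)) u = spine X n x"
    then have "spine X n u = spine X n x" by simp
    then have "edge X n i (Suc i) u = edge X n i (Suc i) x" if "i < n" for i
      using that nth_spine[of i n X] by metis
    moreover have "u \<in> simplices X n" using u by simp
    ultimately show "u = x" using x pm_eqI by blast
  qed (use x in simp)
qed

lemma pprod_spine: "x \<in> simplices X n \<Longrightarrow> pprod X (spine X n x) = edge X n 0 n x"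
  by (simp add: pprod_def Pi_map_def simplex_of_spine)

text \<open>A prefix of a spine is the spine of the face on the vertices 0 to \<open>i\<close>,
  hence again a word; for \<open>i = 0\<close> the product is the unit.\<close>

lemma pprod_take_spine:
  assumes x: "x \<in> simplices X n" and i: "i \<le> n"
  shows "pprod X (take i (spine X n x)) = edge X n 0 i x"
proof -
  let ?\<theta> = "\<lambda>k\<in>{..i}. k"
  have t: "?\<theta> \<in> delta i n" using i by (intro deltaI) auto
  have "spine X i (sact X i n ?\<theta> x) = take i (spine X n x)"
    using i x t by (intro nth_equalityI) (auto simp: edge_sact[OF pm_simplicial])
  moreover have "edge X i 0 i (sact X i n ?\<theta> x) = edge X n 0 i x"
    using edge_sact[OF pm_simplicial t x, of 0 i] by simp
  ultimately show ?thesis using pprod_spine[of "sact X i n ?\<theta> x" i] t x pm_simplicial by simp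
qed

lemma pprod_triangle:
  assumes "w \<in> simplices X 2"
  shows "pprod X [edge X 2 0 1 w, edge X 2 1 2 w] = edge X 2 0 2 w"
proof -
  have "spine X 2 w = [edge X 2 0 1 w, edge X 2 1 2 w]"
    by (rule nth_equalityI) (auto simp: less_2_cases_iff)
  then show ?thesis using pprod_spine[OF assms] by simp
qed

lemma unit_right:
  assumes "x \<in> simplices X 1"
  obtains w where "w \<in> simplices X 2" "edge X 2 0 1 w = x" "edge X 2 1 2 w = unit X"
    "edge X 2 0 2 w = x"
  using edge_triangle[OF pm_simplicial assms, of 0 1 1] assms pm_simplicial
  by (auto simp: edge_const)

lemma unit_left:
  assumes "x \<in> simplices X 1"
  obtains w where "w \<in> simplices X 2" "edge X 2 0 1 w = unit X" "edge X 2 1 2 w = x"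
    "edge X 2 0 2 w = x"
  using edge_triangle[OF pm_simplicial assms, of 0 0 1] assms pm_simplicial
  by (auto simp: edge_const)

text \<open>Folding from the left adds one edge at a time, and each addition is the triangle on the
  vertices \<open>i\<close>, \<open>i + d\<close>, \<open>i + d + 1\<close> of \<open>x\<close>, so
  compatibility of \<open>f\<close> with triangles suffices.\<close>

lemma foldl_spine:
  assumes f1: "f (unit X) = e"
    and f2: "\<And>w. w \<in> simplices X 2 \<Longrightarrow>
      mul (f (edge X 2 0 1 w)) (f (edge X 2 1 2 w)) = f (edge X 2 0 2 w)"
    and x: "x \<in> simplices X n"
  shows "i + d \<le> n \<Longrightarrow> foldl mul e (take d (drop i (map f (spine X n x)))) = f (edge X n i (i + d) x)"
proof (induction d)
  case 0
  then show ?case using f1 x edge_const by simp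
next
  case (Suc d)
  obtain w where w: "w \<in> simplices X 2" "edge X 2 0 1 w = edge X n i (i + d) x"
    "edge X 2 1 2 w = edge X n (i + d) (Suc (i + d)) x"
    "edge X 2 0 2 w = edge X n i (Suc (i + d)) x"
    using edge_triangle[OF pm_simplicial x, of i "i + d" "Suc (i + d)"] Suc.prems by auto
  show ?case using Suc f2[OF w(1)] w by (simp add: take_Suc_conv_app_nth)
qed

text \<open>Used twice: with \<open>f = conj_aut\<close> it makes \<open>\<rho>\<close> simplicial,
  and with \<open>f = coords\<close> it matches the simplicial structure of \<open>E\<close> with
  that of the semidirect product.\<close>

lemma bar_act_spine:
  assumes f1: "f (unit X) = e"
    and f2: "\<And>w. w \<in> simplices X 2 \<Longrightarrow>
      mul (f (edge X 2 0 1 w)) (f (edge X 2 1 2 w)) = f (edge X 2 0 2 w)"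
    and x: "x \<in> simplices X n" and \<theta>: "\<theta> \<in> delta m n"
  shows "bar_act mul e m n \<theta> (map f (spine X n x)) = map f (spine X m (sact X m n \<theta> x))"
proof (rule nth_equalityI)
  fix i assume "i < length (bar_act mul e m n \<theta> (map f (spine X n x)))"
  then have i: "i < m" by (simp add: bar_act_def)
  have le: "\<theta> i \<le> \<theta> (Suc i)" "\<theta> (Suc i) \<le> n"
    using delta_mono[OF \<theta>, of i "Suc i"] delta_le[OF \<theta>, of "Suc i"] i by auto
  show "bar_act mul e m n \<theta> (map f (spine X n x)) ! i = map f (spine X m (sact X m n \<theta> x)) ! i"
    using i le foldl_spine[of f e mul x n "\<theta> i" "\<theta> (Suc i) - \<theta> i", OF f1 f2 x]
      edge_sact[OF pm_simplicial \<theta> x, of i "Suc i"]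
    by (simp add: bar_act_def Suc_eq_plus1[symmetric])
qed (simp add: bar_act_def)

end

lemma word_2:
  assumes X: "partial_monoid X" and w: "w \<in> simplices X 2"
  shows "[edge X 2 0 1 w, edge X 2 1 2 w] \<in> words X 2"
proof -
  have "spine X 2 w = [edge X 2 0 1 w, edge X 2 1 2 w]"
    by (rule nth_equalityI) (auto simp: less_2_cases_iff)
  then show ?thesis using w unfolding words_def by force
qed

lemma pprod_1:
  assumes X: "partial_monoid X" and x: "x \<in> simplices X 1"
  shows "pprod X [] = unit X" "pprod X [x] = x"
  using pprod_take_spine[OF X x, of 0] pprod_spine[OF X x] x pm_simplicial[OF X] edge_const[OF X x]
  by auto

lemma unit_words:
  assumes X: "partial_monoid X" and x: "x \<in> simplices X 1"
  shows "[unit X, x] \<in> words X 2" "pprod X [unit X, x] = x"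
    "[x, unit X] \<in> words X 2" "pprod X [x, unit X] = x"
proof -
  obtain w where "w \<in> simplices X 2" "edge X 2 0 1 w = unit X" "edge X 2 1 2 w = x" "edge X 2 0 2 w = x"
    using unit_left[OF X x] .
  then show "[unit X, x] \<in> words X 2" "pprod X [unit X, x] = x"
    using word_2[OF X, of w] pprod_triangle[OF X, of w] by auto
  obtain v where "v \<in> simplices X 2" "edge X 2 0 1 v = x" "edge X 2 1 2 v = unit X" "edge X 2 0 2 v = x"
    using unit_right[OF X x] .
  then show "[x, unit X] \<in> words X 2" "pprod X [x, unit X] = x"
    using word_2[OF X, of v] pprod_triangle[OF X, of v] by auto
qed

lemma pm_triangle_eq:
  assumes "partial_monoid X" "w \<in> simplices X 2" "w' \<in> simplices X 2"
    "edge X 2 0 1 w = edge X 2 0 1 w'" "edge X 2 1 2 w = edge X 2 1 2 w'"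
  shows "w = w'"
proof (rule pm_eqI[OF assms(1-3)])
  fix i :: nat assume "i < 2"
  then show "edge X 2 i (Suc i) w = edge X 2 i (Suc i) w'"
    using assms(4,5) by (auto simp: less_2_cases_iff)
qed

section \<open>Simplicial maps, automorphisms and isomorphisms\<close>

definition simplicial_map :: "'a sset \<Rightarrow> 'b sset \<Rightarrow> (nat \<Rightarrow> 'a \<Rightarrow> 'b) \<Rightarrow> bool" where
  "simplicial_map X Y f \<longleftrightarrow>
     (\<forall>n. \<forall>x\<in>simplices X n. f n x \<in> simplices Y n) \<and>
     (\<forall>m n. \<forall>\<theta>\<in>delta m n. \<forall>x\<in>simplices X n. f m (sact X m n \<theta> x) = sact Y m n \<theta> (f n x))"

lemma simplicial_map_in: "simplicial_map X Y f \<Longrightarrow> x \<in> simplices X n \<Longrightarrow> f n x \<in> simplices Y n"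
  unfolding simplicial_map_def by blast

lemma simplicial_map_sact:
  "simplicial_map X Y f \<Longrightarrow> \<theta> \<in> delta m n \<Longrightarrow> x \<in> simplices X n \<Longrightarrow>
     f m (sact X m n \<theta> x) = sact Y m n \<theta> (f n x)"
  unfolding simplicial_map_def by blast

lemma simplicial_map_edge:
  "simplicial_map X Y f \<Longrightarrow> i \<le> j \<Longrightarrow> j \<le> n \<Longrightarrow> x \<in> simplices X n \<Longrightarrow>
     f 1 (edge X n i j x) = edge Y n i j (f n x)"
  by (rule simplicial_map_sact) auto

lemma sset_hom_simplicial_map: "sset_hom X Y f \<Longrightarrow> simplicial_map X Y f"
  unfolding simplicial_map_def sset_hom_def by blast

lemma simplicial_map_comp:
  "simplicial_map X Y f \<Longrightarrow> simplicial_map Y Z g \<Longrightarrow> simplicial_map X Z (\<lambda>n x. g n (f n x))"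
  unfolding simplicial_map_def by auto

lemma simplicial_map_degen:
  assumes "partial_monoid X" "partial_monoid Y" "simplicial_map X Y f"
  shows "f n (degen X n) = degen Y n"
proof -
  have "f 0 (vertex X) = vertex Y"
    using assms pm_vertex pm_vertex_unique simplicial_map_in by metis
  then show ?thesis
    unfolding degen_def
    using simplicial_map_sact[OF assms(3), of "delta_const n 0" n 0] pm_vertex[OF assms(1)] by simp
qed

lemma simplicial_map_unit:
  "partial_monoid X \<Longrightarrow> partial_monoid Y \<Longrightarrow> simplicial_map X Y f \<Longrightarrow> f 1 (unit X) = unit Y"
  unfolding unit_degen by (rule simplicial_map_degen)

text \<open>Like \<open>simplicial_map\<close>, this leaves the values off the simplices free,
  unlike the elements of \<open>aut_group X\<close>; thus plain composites and inverses are again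
  automorphisms.\<close>

definition automorphism :: "'a sset \<Rightarrow> (nat \<Rightarrow> 'a \<Rightarrow> 'a) \<Rightarrow> bool" where
  "automorphism X f \<longleftrightarrow>
     simplicial_map X X f \<and> (\<forall>n. bij_betw (f n) (simplices X n) (simplices X n))"

lemma automorphism_map: "automorphism X f \<Longrightarrow> simplicial_map X X f"
  unfolding automorphism_def by blast

lemma automorphism_bij: "automorphism X f \<Longrightarrow> bij_betw (f n) (simplices X n) (simplices X n)"
  unfolding automorphism_def by blast

lemma automorphism_id: "automorphism X (\<lambda>n x. x)"
  by (simp add: automorphism_def simplicial_map_def bij_betw_def)

lemma automorphism_comp:
  "automorphism X f \<Longrightarrow> automorphism X g \<Longrightarrow> automorphism X (\<lambda>n x. g n (f n x))"
  unfolding automorphism_def using simplicial_map_comp bij_betw_trans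
  by (fastforce simp: comp_def)

lemma automorphism_inverse:
  assumes "simplicial_set X" "automorphism X f"
  obtains g where "automorphism X g"
    "\<And>n x. x \<in> simplices X n \<Longrightarrow> f n (g n x) = x" "\<And>n x. x \<in> simplices X n \<Longrightarrow> g n (f n x) = x"
proof
  let ?g = "\<lambda>n. inv_into (simplices X n) (f n)"
  note b = automorphism_bij[OF assms(2)]
  show fg: "f n (?g n x) = x" if "x \<in> simplices X n" for n x
    using b that by (meson bij_betw_inv_into_right)
  show gf: "?g n (f n x) = x" if "x \<in> simplices X n" for n x
    using b that by (meson bij_betw_inv_into_left)
  have gin: "?g n x \<in> simplices X n" if "x \<in> simplices X n" for n x
    using b[of n] that by (metis bij_betw_def inv_into_into)
  have "?g m (sact X m n \<theta> x) = sact X m n \<theta> (?g n x)"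
    if "\<theta> \<in> delta m n" "x \<in> simplices X n" for m n \<theta> x
    using simplicial_map_sact[OF automorphism_map[OF assms(2)] that(1) gin[OF that(2)]] fg[OF that(2)]
      gf[of "sact X m n \<theta> (?g n x)" m] that gin assms(1) by simp
  then show "automorphism X ?g"
    unfolding automorphism_def simplicial_map_def using gin b bij_betw_inv_into by blast
qed

lemma automorphism_sset_iso: "sset_iso X X f \<Longrightarrow> automorphism X f"
  using sset_hom_simplicial_map unfolding automorphism_def sset_iso_def by blast

lemma sset_iso_simplicial: "sset_iso X Y f \<Longrightarrow> simplicial_set X"
  unfolding sset_iso_def sset_hom_def by blast

lemma sset_iso_extensional: "sset_iso X Y f \<Longrightarrow> f n \<in> extensional (simplices X n)"
  unfolding sset_iso_def sset_hom_def by (auto simp: PiE_iff)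

lemma sset_iso_comp:
  assumes f: "sset_iso X Y f" and g: "sset_iso Y Z g"
  shows "sset_iso X Z (sset_comp X g f)"
  unfolding sset_iso_def sset_hom_def
proof safe
  show "simplicial_set X" using f sset_iso_simplicial by blast
  show "simplicial_set Z" using g unfolding sset_iso_def sset_hom_def by blast
  have fm: "simplicial_map X Y f" and gm: "simplicial_map Y Z g"
    using f g unfolding sset_iso_def by (auto intro: sset_hom_simplicial_map)
  note fg = simplicial_map_comp[OF fm gm]
  show "sset_comp X g f n x \<in> simplices Z n" if "x \<in> simplices X n" for n x
    using simplicial_map_in[OF fg that] that by (simp add: sset_comp_def compose_eq)
  show "sset_comp X g f n x = undefined" if "x \<notin> simplices X n" for n x
    using that by (simp add: sset_comp_def compose_def)
  show "sset_comp X g f m (sact X m n \<theta> x) = sact Z m n \<theta> (sset_comp X g f n x)"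
    if "\<theta> \<in> delta m n" "x \<in> simplices X n" for m n \<theta> x
    using simplicial_map_sact[OF fg that] that \<open>simplicial_set X\<close>
    by (simp add: sset_comp_def compose_eq)
  have "bij_betw (f n) (simplices X n) (simplices Y n)" "bij_betw (g n) (simplices Y n) (simplices Z n)" for n
    using f g unfolding sset_iso_def by auto
  then have "bij_betw (g n \<circ> f n) (simplices X n) (simplices Z n)" for n
    using bij_betw_trans by blast
  moreover have "bij_betw (sset_comp X g f n) (simplices X n) (simplices Z n) =
      bij_betw (g n \<circ> f n) (simplices X n) (simplices Z n)" for n
    by (rule bij_betw_cong) (simp add: sset_comp_def compose_eq)
  ultimately show "bij_betw (sset_comp X g f n) (simplices X n) (simplices Z n)" for n by simp
qed

lemma sset_iso_id: "simplicial_set X \<Longrightarrow> sset_iso X X (sset_id X)"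
  unfolding sset_iso_def sset_hom_def sset_id_def
  by (auto simp: bij_betw_def inj_on_def)

text \<open>Simplices of \<open>Y\<close> are determined by their edges, and simplicial maps commute
  with taking edges. Automorphisms of \<open>M\<close> therefore need to be compared in degree 1
  only.\<close>

lemma sset_iso_eqI:
  assumes Y: "partial_monoid Y" and f: "sset_iso X Y f" and g: "sset_iso X Y g"
    and eq: "\<And>x. x \<in> simplices X 1 \<Longrightarrow> f 1 x = g 1 x"
  shows "f = g"
proof (rule ext, rule extensionalityI)
  fix n
  show "f n \<in> extensional (simplices X n)" "g n \<in> extensional (simplices X n)"
    using f g sset_iso_extensional by blast+
  have fm: "simplicial_map X Y f" and gm: "simplicial_map X Y g"
    using f g unfolding sset_iso_def by (auto intro: sset_hom_simplicial_map)
  fix x assume x: "x \<in> simplices X n"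
  show "f n x = g n x"
  proof (rule pm_eqI[OF Y])
    fix i assume "i < n"
    then show "edge Y n i (Suc i) (f n x) = edge Y n i (Suc i) (g n x)"
      using simplicial_map_edge[OF fm _ _ x, of i "Suc i"] simplicial_map_edge[OF gm _ _ x, of i "Suc i"]
        eq[of "edge X n i (Suc i) x"] x sset_iso_simplicial[OF f] by simp
  qed (rule simplicial_map_in[OF fm x] simplicial_map_in[OF gm x])+
qed

text \<open>The simplicial identities of \<open>Y\<close> are transported from \<open>X\<close>
  along the bijections. For the semidirect product this replaces a direct check that the twisted
  words form a simplicial set.\<close>

lemma sset_iso_transport:
  assumes X: "simplicial_set X"
    and bij: "\<And>n. bij_betw (f n) (simplices X n) (simplices Y n)"
    and act: "\<And>m n \<theta> x. \<theta> \<in> delta m n \<Longrightarrow> x \<in> simplices X n \<Longrightarrow>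
      f m (sact X m n \<theta> x) = sact Y m n \<theta> (f n x)"
  shows "sset_iso Y X (\<lambda>n. \<lambda>y\<in>simplices Y n. inv_into (simplices X n) (f n) y)"
proof -
  define g where "g n = inv_into (simplices X n) (f n)" for n
  have g: "bij_betw (g n) (simplices Y n) (simplices X n)" for n
    unfolding g_def by (rule bij_betw_inv_into[OF bij])
  have fg: "f n (g n y) = y" if "y \<in> simplices Y n" for n y
    unfolding g_def using bij_betw_inv_into_right[OF bij that] .
  have gf: "g n (f n x) = x" if "x \<in> simplices X n" for n x
    unfolding g_def using bij_betw_inv_into_left[OF bij that] .
  have f_in: "f n x \<in> simplices Y n" if "x \<in> simplices X n" for n x using bij_betw_apply[OF bij that] .
  have g_in: "g n y \<in> simplices X n" if "y \<in> simplices Y n" for n y using bij_betw_apply[OF g that] .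
  have actY: "sact Y m n \<theta> y = f m (sact X m n \<theta> (g n y))" if "\<theta> \<in> delta m n" "y \<in> simplices Y n" for m n \<theta> y
    using act[OF that(1) g_in[OF that(2)]] fg[OF that(2)] by simp
  have Y_in: "sact Y m n \<theta> y \<in> simplices Y m" if "\<theta> \<in> delta m n" "y \<in> simplices Y n" for m n \<theta> y
    using actY that f_in g_in X by simp
  have "simplicial_set Y"
    unfolding simplicial_set_def
  proof (intro conjI allI ballI)
    show "sact Y m n \<theta> y \<in> simplices Y m" if "\<theta> \<in> delta m n" "y \<in> simplices Y n" for m n \<theta> y
      using Y_in that .
    show "sact Y n n (delta_id n) y = y" if "y \<in> simplices Y n" for n y
      using actY[OF delta_id_in that] fg that g_in X by simp
    show "sact Y l n (compose {..l} \<theta> \<alpha>) y = sact Y l m \<alpha> (sact Y m n \<theta> y)"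
      if "\<alpha> \<in> delta l m" "\<theta> \<in> delta m n" "y \<in> simplices Y n" for l m n \<alpha> \<theta> y
    proof -
      have "g m (sact Y m n \<theta> y) = sact X m n \<theta> (g n y)"
        using actY[OF that(2,3)] gf that g_in X by simp
      then show ?thesis
        using actY[OF _ that(3)] actY[OF that(1) Y_in[OF that(2,3)]] that g_in X
        by (simp add: sact_sact)
    qed
  qed
  moreover have "bij_betw (\<lambda>y\<in>simplices Y n. g n y) (simplices Y n) (simplices X n)" for n
    using g[of n] by (simp add: bij_betw_restrict_eq)
  moreover have "g m (sact Y m n \<theta> y) = sact X m n \<theta> (g n y)"
    if "\<theta> \<in> delta m n" "y \<in> simplices Y n" for m n \<theta> y
    using actY[OF that] gf that g_in X by simp
  ultimately show ?thesis
    unfolding g_def[symmetric] sset_iso_def sset_hom_def using X g_in Y_in by auto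
qed

section \<open>Maps from cylinders\<close>

text \<open>A simplicial map from \<open>M \<times> \<Delta>[n]\<close> to \<open>X\<close>, in curried form and with no condition on the
  values outside the domain.\<close>

definition cylinder_map ::
  "'a sset \<Rightarrow> nat \<Rightarrow> 'b sset \<Rightarrow> (nat \<Rightarrow> 'a \<Rightarrow> (nat \<Rightarrow> nat) \<Rightarrow> 'b) \<Rightarrow> bool" where
  "cylinder_map M n X G \<longleftrightarrow>
     (\<forall>k. \<forall>u\<in>simplices M k. \<forall>t\<in>delta k n. G k u t \<in> simplices X k) \<and>
     (\<forall>k l. \<forall>\<theta>\<in>delta k l. \<forall>u\<in>simplices M l. \<forall>t\<in>delta l n.
        G k (sact M k l \<theta> u) (compose {..k} t \<theta>) = sact X k l \<theta> (G l u t))"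

lemma cylinder_in:
  "cylinder_map M n X G \<Longrightarrow> u \<in> simplices M k \<Longrightarrow> t \<in> delta k n \<Longrightarrow> G k u t \<in> simplices X k"
  unfolding cylinder_map_def by blast

lemma cylinder_sact:
  "cylinder_map M n X G \<Longrightarrow> \<theta> \<in> delta k l \<Longrightarrow> u \<in> simplices M l \<Longrightarrow> t \<in> delta l n \<Longrightarrow>
     G k (sact M k l \<theta> u) (compose {..k} t \<theta>) = sact X k l \<theta> (G l u t)"
  unfolding cylinder_map_def by blast

lemma cylinder_edge:
  assumes "cylinder_map M n X G" "u \<in> simplices M l" "t \<in> delta l n" "i \<le> j" "j \<le> l"
  shows "edge X l i j (G l u t) = G 1 (edge M l i j u) (delta_edge (t i) (t j))"
  using cylinder_sact[OF assms(1) _ assms(2,3), of "delta_edge i j" 1] assms by simp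

text \<open>The diagonal edge over \<open>x\<close> and \<open>i \<le> j\<close> is \<open>x\<close>
  over the vertex \<open>i\<close> followed by the base edge: take the image of a degenerate
  triangle on \<open>x\<close> paired with \<open>(i, i, j)\<close>. Pairing with
  \<open>(i, j, j)\<close> gives the factorization in the other order, and comparing the two is the
  source of all conjugation relations below.\<close>

lemma cylinder_edge_left:
  assumes "partial_monoid M" "cylinder_map M n X G" "x \<in> simplices M 1" "i \<le> j" "j \<le> n"
  obtains w where "w \<in> simplices X 2" "edge X 2 0 1 w = G 1 x (delta_const 1 i)"
    "edge X 2 1 2 w = G 1 (unit M) (delta_edge i j)" "edge X 2 0 2 w = G 1 x (delta_edge i j)"
proof -
  obtain m where m: "m \<in> simplices M 2" "edge M 2 0 1 m = x" "edge M 2 1 2 m = unit M"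
    "edge M 2 0 2 m = x"
    using unit_right[OF assms(1,3)] by metis
  have t: "delta_tri i i j \<in> delta 2 n" using assms by simp
  show ?thesis
    by (rule that[of "G 2 m (delta_tri i i j)"])
      (use m t cylinder_in[OF assms(2)] cylinder_edge[OF assms(2) m(1) t] in auto)
qed

lemma cylinder_edge_right:
  assumes "partial_monoid M" "cylinder_map M n X G" "x \<in> simplices M 1" "i \<le> j" "j \<le> n"
  obtains w where "w \<in> simplices X 2" "edge X 2 0 1 w = G 1 (unit M) (delta_edge i j)"
    "edge X 2 1 2 w = G 1 x (delta_const 1 j)" "edge X 2 0 2 w = G 1 x (delta_edge i j)"
proof -
  obtain m where m: "m \<in> simplices M 2" "edge M 2 0 1 m = unit M" "edge M 2 1 2 m = x"
    "edge M 2 0 2 m = x"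
    using unit_left[OF assms(1,3)] by metis
  have t: "delta_tri i j j \<in> delta 2 n" using assms by simp
  show ?thesis
    by (rule that[of "G 2 m (delta_tri i j j)"])
      (use m t cylinder_in[OF assms(2)] cylinder_edge[OF assms(2) m(1) t] in auto)
qed

text \<open>By \<open>cylinder_edge_left\<close> every edge in the image is the product of an edge
  over a vertex and a base edge, and simplices of \<open>X\<close> are determined by their
  edges.\<close>

lemma cylinder_unique:
  assumes M: "partial_monoid M" and X: "partial_monoid X"
    and G: "cylinder_map M n X G" and G': "cylinder_map M n X G'"
    and c: "\<And>x i. x \<in> simplices M 1 \<Longrightarrow> i \<le> n \<Longrightarrow> G 1 x (delta_const 1 i) = G' 1 x (delta_const 1 i)"
    and e: "\<And>i j. i \<le> j \<Longrightarrow> j \<le> n \<Longrightarrow>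
      G 1 (unit M) (delta_edge i j) = G' 1 (unit M) (delta_edge i j)"
    and u: "u \<in> simplices M k" and t: "t \<in> delta k n"
  shows "G k u t = G' k u t"
proof (rule pm_eqI[OF X])
  have *: "G 1 x (delta_edge i j) = G' 1 x (delta_edge i j)"
    if x: "x \<in> simplices M 1" "i \<le> j" "j \<le> n" for x i j
  proof -
    obtain w where w: "w \<in> simplices X 2" "edge X 2 0 1 w = G 1 x (delta_const 1 i)"
      "edge X 2 1 2 w = G 1 (unit M) (delta_edge i j)" "edge X 2 0 2 w = G 1 x (delta_edge i j)"
      using cylinder_edge_left[OF M G x] by metis
    obtain w' where w': "w' \<in> simplices X 2" "edge X 2 0 1 w' = G' 1 x (delta_const 1 i)"
      "edge X 2 1 2 w' = G' 1 (unit M) (delta_edge i j)" "edge X 2 0 2 w' = G' 1 x (delta_edge i j)"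
      using cylinder_edge_left[OF M G' x] by metis
    have "w = w'" by (rule pm_triangle_eq[OF X w(1) w'(1)]) (use w w' c[of x i] e[of i j] x in auto)
    then show ?thesis using w w' by simp
  qed
  fix i assume i: "i < k"
  have "edge M k i (Suc i) u \<in> simplices M 1" "t i \<le> t (Suc i)" "t (Suc i) \<le> n"
    using u t i pm_simplicial[OF M] delta_mono[OF t] delta_le[OF t] by auto
  then show "edge X k i (Suc i) (G k u t) = edge X k i (Suc i) (G' k u t)"
    using cylinder_edge[OF G u t] cylinder_edge[OF G' u t] i * by simp
qed (use cylinder_in[OF G u t] cylinder_in[OF G' u t] in auto)

lemma cylinder_pre:
  assumes "simplicial_map L M f" "cylinder_map M n X G"
  shows "cylinder_map L n X (\<lambda>k u. G k (f k u))"
  using assms unfolding cylinder_map_def simplicial_map_def by simp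

lemma cylinder_post:
  assumes "cylinder_map M n X G" "simplicial_map X Y f"
  shows "cylinder_map M n Y (\<lambda>k u t. f k (G k u t))"
  using assms unfolding cylinder_map_def simplicial_map_def by simp

text \<open>A cylinder map into \<open>M\<close> stands for the self-map
  \<open>(u, t) \<mapsto> (K u t, t)\<close> of \<open>M \<times> \<Delta>[n]\<close> over
  \<open>\<Delta>[n]\<close>; this is composition with such a map.\<close>

lemma cylinder_comp:
  assumes "cylinder_map L n M K" "cylinder_map M n X G"
  shows "cylinder_map L n X (\<lambda>k u t. G k (K k u t) t)"
  using assms unfolding cylinder_map_def by simp

lemma cylinder_pull:
  assumes "q \<in> delta n n'" "cylinder_map M n' X G"
  shows "cylinder_map M n X (\<lambda>k u t. G k u (compose {..k} q t))"
  unfolding cylinder_map_def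
proof safe
  fix k u t assume "u \<in> simplices M k" "t \<in> delta k n"
  then show "G k u (compose {..k} q t) \<in> simplices X k"
    using cylinder_in[OF assms(2)] assms(1) by simp
next
  fix k l \<theta> u t assume a: "\<theta> \<in> delta k l" "u \<in> simplices M l" "t \<in> delta l n"
  then show "G k (sact M k l \<theta> u) (compose {..k} q (compose {..k} t \<theta>)) =
      sact X k l \<theta> (G l u (compose {..l} q t))"
    using cylinder_sact[OF assms(2) a(1,2), of "compose {..l} q t"] assms(1)
      compose_delta_assoc[OF a(1), of q t] by simp
qed

lemma cylinder_fst: "simplicial_map M X f \<Longrightarrow> cylinder_map M n X (\<lambda>k u t. f k u)"
  unfolding cylinder_map_def simplicial_map_def by simp

section \<open>Inverses in partial groups\<close>

context
  fixes X :: "'a sset" and \<nu>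
  assumes X: "partial_monoid X" and \<nu>: "inversion X \<nu>"
begin

lemma inversion_in: "x \<in> simplices X n \<Longrightarrow> \<nu> n x \<in> simplices X n"
  using \<nu> unfolding inversion_def sset_hom_def sset_op_def by auto

lemma inversion_invol: "x \<in> simplices X n \<Longrightarrow> \<nu> n (\<nu> n x) = x"
  using \<nu> unfolding inversion_def by auto

lemma inversion_sact:
  "x \<in> simplices X n \<Longrightarrow> \<theta> \<in> delta m n \<Longrightarrow>
    \<nu> m (sact X m n \<theta> x) = sact X m n (\<lambda>k\<in>{..m}. n - \<theta> (m - k)) (\<nu> n x)"
  using \<nu> unfolding inversion_def sset_hom_def sset_op_def by auto

lemma inversion_edge:
  "x \<in> simplices X n \<Longrightarrow> i \<le> j \<Longrightarrow> j \<le> n \<Longrightarrow>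
    \<nu> 1 (edge X n i j x) = edge X n (n - j) (n - i) (\<nu> n x)"
proof -
  assume a: "x \<in> simplices X n" "i \<le> j" "j \<le> n"
  have "(\<lambda>k\<in>{..1}. n - delta_edge i j (1 - k)) = delta_edge (n - j) (n - i)"
    by (auto simp: fun_eq_iff delta_edge_def)
  then show ?thesis using inversion_sact[OF a(1), of "delta_edge i j" 1] a by simp
qed

lemma inversion_left:
  assumes "x \<in> simplices X 1"
  obtains w where "w \<in> simplices X 2" "edge X 2 0 1 w = \<nu> 1 x" "edge X 2 1 2 w = x"
    "edge X 2 0 2 w = unit X"
proof -
  obtain w where w: "w \<in> simplices X 2" "spine X 2 w = spine X 1 (\<nu> 1 x) @ spine X 1 x"
    "Pi_map X 2 w = unit X"
    using \<nu> assms unfolding inversion_def by (metis le_refl mult.right_neutral)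
  then have *: "spine X 2 w = [\<nu> 1 x, x]"
    using assms inversion_in pm_simplicial[OF X] by simp
  show ?thesis
  proof (rule that[OF w(1)])
    show "edge X 2 0 1 w = \<nu> 1 x" "edge X 2 1 2 w = x"
      using nth_spine[of 0 2 X w] nth_spine[of 1 2 X w] * by auto
  qed (use w(3) in \<open>simp add: Pi_map_def\<close>)
qed

lemma inversion_right:
  assumes "x \<in> simplices X 1"
  obtains w where "w \<in> simplices X 2" "edge X 2 0 1 w = x" "edge X 2 1 2 w = \<nu> 1 x"
    "edge X 2 0 2 w = unit X"
  using inversion_left[OF inversion_in[OF assms]] assms inversion_invol by metis

text \<open>From \<open>[y|x]\<close> with product 1 one gets \<open>[y|x|x\<^sup>-\<^sup>1|y\<^sup>-\<^sup>1]\<close>, and bracketing \<open>y x x\<^sup>-\<^sup>1\<close> in two ways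
  gives \<open>y = x\<^sup>-\<^sup>1\<close>.\<close>

lemma inversion_unique:
  assumes w: "w \<in> simplices X 2" and 1: "edge X 2 0 2 w = unit X"
  shows "edge X 2 0 1 w = \<nu> 1 (edge X 2 1 2 w)"
proof -
  note X1 = pm_simplicial[OF X]
  let ?x = "edge X 2 1 2 w" and ?y = "edge X 2 0 1 w"
  have xy: "?x \<in> simplices X 1" "?y \<in> simplices X 1" using w X1 by auto
  have "\<forall>u\<in>simplices X 2. \<exists>w\<in>simplices X (2 * 2). spine X (2 * 2) w = spine X 2 (\<nu> 2 u) @ spine X 2 u"
    using \<nu> unfolding inversion_def by (metis one_le_numeral)
  \<comment> \<open>The axiom is applied to \<open>\<nu> 2 w\<close>, whose inverse is
    \<open>w\<close>, so that the word begins with \<open>w\<close>.\<close>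
  then obtain W where W: "W \<in> simplices X 4" "spine X 4 W = spine X 2 w @ spine X 2 (\<nu> 2 w)"
    using inversion_in[OF w] inversion_invol[OF w] by force
  have W01: "edge X 4 0 1 W = ?y" and W12: "edge X 4 1 2 W = ?x"
    using nth_spine[of 0 4 X W] nth_spine[of 1 4 X W] W(2) by (auto simp: nth_append)
  have "edge X 4 2 3 W = edge X 2 0 1 (\<nu> 2 w)"
    using nth_spine[of 2 4 X W] W(2) by (auto simp: nth_append)
  then have W23: "edge X 4 2 3 W = \<nu> 1 ?x" using inversion_edge[OF w, of 1 2] by simp
  obtain p where p: "p \<in> simplices X 2" "edge X 2 0 1 p = ?y" "edge X 2 1 2 p = ?x"
    "edge X 2 0 2 p = edge X 4 0 2 W"
    using edge_triangle[OF X1 W(1), of 0 1 2] W01 W12 by auto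
  have 02: "edge X 4 0 2 W = unit X"
    using pm_triangle_eq[OF X p(1) w p(2,3)] p(4) 1 by simp
  obtain q where q: "q \<in> simplices X 2" "edge X 2 0 1 q = ?x" "edge X 2 1 2 q = \<nu> 1 ?x"
    "edge X 2 0 2 q = edge X 4 1 3 W"
    using edge_triangle[OF X1 W(1), of 1 2 3] W12 W23 by auto
  obtain r where r: "r \<in> simplices X 2" "edge X 2 0 1 r = ?x" "edge X 2 1 2 r = \<nu> 1 ?x"
    "edge X 2 0 2 r = unit X"
    using inversion_right[OF xy(1)] by metis
  have 13: "edge X 4 1 3 W = unit X"
    using pm_triangle_eq[OF X q(1) r(1)] q r by simp
  obtain a where a: "a \<in> simplices X 2" "edge X 2 0 1 a = unit X" "edge X 2 1 2 a = \<nu> 1 ?x"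
    "edge X 2 0 2 a = edge X 4 0 3 W"
    using edge_triangle[OF X1 W(1), of 0 2 3] 02 W23 by auto
  obtain b where b: "b \<in> simplices X 2" "edge X 2 0 1 b = ?y" "edge X 2 1 2 b = unit X"
    "edge X 2 0 2 b = edge X 4 0 3 W"
    using edge_triangle[OF X1 W(1), of 0 1 3] 13 W01 by auto
  have "edge X 2 0 2 a = \<nu> 1 ?x"
    using unit_left[OF X inversion_in[OF xy(1)]] pm_triangle_eq[OF X a(1)] a(2,3) by metis
  moreover have "edge X 2 0 2 b = ?y"
    using unit_right[OF X xy(2)] pm_triangle_eq[OF X b(1)] b(2,3) by metis
  ultimately show ?thesis using a b by simp
qed

end

text \<open>The image of the triangle \<open>[\<nu> x|x]\<close> with product 1 is again a triangle
  with product 1, and inverses are unique in \<open>Y\<close>.\<close>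

lemma simplicial_map_inversion:
  assumes "partial_monoid X" "inversion X \<nu>" "partial_monoid Y" "inversion Y \<mu>"
    "simplicial_map X Y f" "x \<in> simplices X 1"
  shows "f 1 (\<nu> 1 x) = \<mu> 1 (f 1 x)"
proof -
  obtain w where w: "w \<in> simplices X 2" "edge X 2 0 1 w = \<nu> 1 x" "edge X 2 1 2 w = x"
    "edge X 2 0 2 w = unit X"
    using inversion_left[OF assms(1,2,6)] by metis
  have "f 2 w \<in> simplices Y 2" using w assms(5) simplicial_map_in by metis
  moreover have "edge Y 2 0 1 (f 2 w) = f 1 (\<nu> 1 x)" "edge Y 2 1 2 (f 2 w) = f 1 x"
    "edge Y 2 0 2 (f 2 w) = unit Y"
    using simplicial_map_edge[OF assms(5) _ _ w(1), symmetric] w(2-4)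
      simplicial_map_unit[OF assms(1,3,5)] by auto
  ultimately show ?thesis using inversion_unique[OF assms(3,4)] by metis
qed

text \<open>The inverse is obtained by conjugating with the inversion of \<open>M\<close> and the order-reversing
  symmetry of \<open>\<Delta>[1]\<close>, which turns \<open>[c x\<^sub>1|\<dots>|c x\<^sub>k s|\<dots>|d x\<^sub>n]\<close> into
  \<open>[d x\<^sub>1|\<dots>|s\<^sup>-\<^sup>1 c x\<^sub>k|\<dots>|c x\<^sub>n]\<close>.\<close>

lemma cylinder_map_bij:
  assumes M: "partial_group M" and K: "cylinder_map M 1 M K"
    and c: "automorphism M c" and d: "automorphism M d"
    and K0: "\<And>x. x \<in> simplices M 1 \<Longrightarrow> K 1 x (delta_const 1 0) = c 1 x"
    and K1: "\<And>x. x \<in> simplices M 1 \<Longrightarrow> K 1 x (delta_const 1 1) = d 1 x"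
    and t: "t \<in> delta k 1"
  shows "bij_betw (\<lambda>u. K k u t) (simplices M k) (simplices M k)"
proof -
  have pm: "partial_monoid M" using M by (simp add: partial_group_def)
  note sM = pm_simplicial[OF pm]
  obtain \<nu> where \<nu>: "inversion M \<nu>" using M by (auto simp: partial_group_def)
  note \<nu>in = inversion_in[OF pm \<nu>]
  obtain c' where c': "automorphism M c'" "\<And>n x. x \<in> simplices M n \<Longrightarrow> c n (c' n x) = x"
    "\<And>n x. x \<in> simplices M n \<Longrightarrow> c' n (c n x) = x"
    using automorphism_inverse[OF sM c] by metis
  obtain d' where d': "automorphism M d'" "\<And>n x. x \<in> simplices M n \<Longrightarrow> d n (d' n x) = x"
    "\<And>n x. x \<in> simplices M n \<Longrightarrow> d' n (d n x) = x"
    using automorphism_inverse[OF sM d] by metis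
  note c'in = simplicial_map_in[OF automorphism_map[OF c'(1)]]
  note d'in = simplicial_map_in[OF automorphism_map[OF d'(1)]]
  note cin = simplicial_map_in[OF automorphism_map[OF c]]
  note din = simplicial_map_in[OF automorphism_map[OF d]]
  note c\<nu> = simplicial_map_inversion[OF pm \<nu> pm \<nu> automorphism_map[OF c]]
  note d\<nu> = simplicial_map_inversion[OF pm \<nu> pm \<nu> automorphism_map[OF d]]
  \<comment> \<open>Both the source \<open>[l]\<close> and the target \<open>[1]\<close> are
    reversed. The first reversal matches the one built into the inversion, so \<open>R\<close> below
    is again a cylinder map; the second interchanges its ends.\<close>
  define flip where "flip l t = (\<lambda>k\<in>{..l::nat}. 1 - t (l - k) :: nat)" for l t
  have flip_in: "flip l t \<in> delta l 1" if "t \<in> delta l 1" for l t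
    unfolding flip_def using delta_mono[OF that] by (intro deltaI) (auto intro!: diff_le_mono2)
  define R where "R k u t = \<nu> k (K k (\<nu> k u) (flip k t))" for k u t
  have R: "cylinder_map M 1 M R"
    unfolding cylinder_map_def
  proof safe
    fix k u t assume "u \<in> simplices M k" "t \<in> delta k 1"
    then show "R k u t \<in> simplices M k"
      unfolding R_def by (intro \<nu>in cylinder_in[OF K] flip_in)
  next
    fix k l \<theta> u t assume a: "\<theta> \<in> delta k l" "u \<in> simplices M l" "t \<in> delta l 1"
    let ?\<theta> = "\<lambda>i\<in>{..k}. l - \<theta> (k - i)"
    have \<theta>': "?\<theta> \<in> delta k l"
      using delta_mono[OF a(1)] by (intro deltaI) (auto intro!: diff_le_mono2)
    have "flip k (compose {..k} t \<theta>) = compose {..k} (flip l t) ?\<theta>"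
      using delta_le[OF a(1)] by (auto simp: fun_eq_iff flip_def compose_def)
    moreover have "(\<lambda>i\<in>{..k}. l - ?\<theta> (k - i)) = \<theta>"
      by (rule delta_eqI[of _ k l _ l])
        (use a(1) delta_le[OF a(1)] delta_mono[OF \<theta>'] in \<open>auto intro!: deltaI diff_le_mono2 delta_mono[OF a(1)]\<close>)
    ultimately show "R k (sact M k l \<theta> u) (compose {..k} t \<theta>) = sact M k l \<theta> (R l u t)"
      unfolding R_def
      using inversion_sact[OF pm \<nu> a(2,1)] cylinder_sact[OF K \<theta>' \<nu>in[OF a(2)] flip_in[OF a(3)]]
        inversion_sact[OF pm \<nu> cylinder_in[OF K \<nu>in[OF a(2)] flip_in[OF a(3)]] \<theta>'] by simp
  qed
  have f0: "flip 1 (delta_const 1 0) = delta_const 1 1" and f1: "flip 1 (delta_const 1 1) = delta_const 1 0"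
    and fe: "flip 1 (delta_edge 0 1) = delta_edge 0 1"
    by (auto simp: flip_def delta_const_def delta_edge_def fun_eq_iff)
  have R0: "R 1 x (delta_const 1 0) = d 1 x" if "x \<in> simplices M 1" for x
    unfolding R_def f0 using K1 d\<nu> \<nu>in din that inversion_invol[OF pm \<nu>] by simp
  have R1: "R 1 x (delta_const 1 1) = c 1 x" if "x \<in> simplices M 1" for x
    unfolding R_def f1 using K0 c\<nu> \<nu>in cin that inversion_invol[OF pm \<nu>] by simp
  define s where "s = K 1 (unit M) (delta_edge 0 1)"
  have s: "s \<in> simplices M 1" unfolding s_def by (rule cylinder_in[OF K]) (use pm in auto)
  have "\<nu> 1 (unit M) = unit M"
    using inversion_unique[OF pm \<nu>] unit_left[OF pm unit_in[OF pm]] by metis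
  then have Re: "R 1 (unit M) (delta_edge 0 1) = \<nu> 1 s" unfolding R_def fe s_def by simp
  \<comment> \<open>\<open>R\<close> has the ends \<open>d\<close> and \<open>c\<close>. Composing
    with \<open>d'\<close> before and \<open>c'\<close> after gives the ends \<open>c'\<close> and
    \<open>d'\<close>, as the inverse of \<open>K\<close> must have.\<close>
  define L where "L k u t = c' k (R k (d' k u) t)" for k u t
  have L: "cylinder_map M 1 M L"
    unfolding L_def
    using cylinder_post[OF cylinder_pre[OF automorphism_map[OF d'(1)] R] automorphism_map[OF c'(1)]] .
  have L0: "L 1 x (delta_const 1 0) = c' 1 x" if "x \<in> simplices M 1" for x
    unfolding L_def using that R0 d' d'in by simp
  have L1: "L 1 x (delta_const 1 1) = d' 1 x" if "x \<in> simplices M 1" for x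
    unfolding L_def using that R1 c' d'in by simp
  have Le: "L 1 (unit M) (delta_edge 0 1) = c' 1 (\<nu> 1 s)"
    unfolding L_def using Re simplicial_map_unit[OF pm pm automorphism_map[OF d'(1)]] by simp
  have c's: "c' 1 (\<nu> 1 s) \<in> simplices M 1" by (intro c'in \<nu>in s)
  have ends: "i = 0 \<or> i = 1" if "i \<le> 1" for i :: nat using that by linarith
  \<comment> \<open>By \<open>cylinder_unique\<close> a cylinder map is the identity as soon as it
    is so over both vertices and on the base edge. This will be applied to both composites of
    \<open>K\<close> and \<open>L\<close>.\<close>
  have inv: "G k u t = u" if G: "cylinder_map M 1 M G"
    and G0: "\<And>x. x \<in> simplices M 1 \<Longrightarrow> G 1 x (delta_const 1 0) = x"
    and G1: "\<And>x. x \<in> simplices M 1 \<Longrightarrow> G 1 x (delta_const 1 1) = x"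
    and Ge: "G 1 (unit M) (delta_edge 0 1) = unit M"
    and u: "u \<in> simplices M k" for G u
  proof (rule cylinder_unique[OF pm pm G cylinder_fst[OF automorphism_map[OF automorphism_id]] _ _ u t])
    fix i j :: nat assume "i \<le> j" "j \<le> 1"
    then have "(i = 0 \<and> j = 1) \<or> i = j \<and> (i = 0 \<or> i = 1)" by linarith
    then show "G 1 (unit M) (delta_edge i j) = unit M" using G0 G1 Ge unit_in[OF pm] by auto
  qed (use G0 G1 ends in blast)
  have KL: "K k (L k u t) t = u" if "u \<in> simplices M k" for u
  proof (rule inv[OF cylinder_comp[OF L K] _ _ _ that])
    obtain w where w: "w \<in> simplices M 2" "edge M 2 0 1 w = K 1 (c' 1 (\<nu> 1 s)) (delta_const 1 0)"
      "edge M 2 1 2 w = s" "edge M 2 0 2 w = K 1 (c' 1 (\<nu> 1 s)) (delta_edge 0 1)"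
      using cylinder_edge_left[OF pm K c's, of 0 1] unfolding s_def by auto
    \<comment> \<open>\<open>K\<close> over the vertex 0 is \<open>c\<close>, which cancels
      \<open>c'\<close>; hence \<open>w\<close> is the triangle \<open>[\<nu> s|s]\<close> with
      product 1.\<close>
    have "edge M 2 0 2 w = unit M"
      using inversion_left[OF pm \<nu> s] pm_triangle_eq[OF pm w(1)] w(2,3) K0[OF c's] c'(2)[OF \<nu>in[OF s]]
      by metis
    then show "K 1 (L 1 (unit M) (delta_edge 0 1)) (delta_edge 0 1) = unit M" using w(4) Le by simp
  qed (use K0 K1 L0 L1 c' d' c'in d'in in auto)
  have LK: "L k (K k u t) t = u" if "u \<in> simplices M k" for u
  proof (rule inv[OF cylinder_comp[OF K L] _ _ _ that])
    obtain w where w: "w \<in> simplices M 2" "edge M 2 0 1 w = L 1 s (delta_const 1 0)"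
      "edge M 2 1 2 w = L 1 (unit M) (delta_edge 0 1)" "edge M 2 0 2 w = L 1 s (delta_edge 0 1)"
      using cylinder_edge_left[OF pm L s, of 0 1] by auto
    obtain v where v: "v \<in> simplices M 2" "edge M 2 0 1 v = s" "edge M 2 1 2 v = \<nu> 1 s"
      "edge M 2 0 2 v = unit M"
      using inversion_right[OF pm \<nu> s] by metis
    note e = simplicial_map_edge[OF automorphism_map[OF c'(1)] _ _ v(1), symmetric]
    \<comment> \<open>Since \<open>L\<close> over the vertex 0 is \<open>c'\<close>, the two factors
      are the images under \<open>c'\<close> of \<open>s\<close> and \<open>\<nu> s\<close>.\<close>
    have "w = c' 2 v"
      by (rule pm_triangle_eq[OF pm w(1) c'in[OF v(1)]])
        (use w(2,3) e[of 0 1] e[of 1 2] v L0[OF s] Le in auto)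
    then have "edge M 2 0 2 w = unit M"
      using e[of 0 2] v(4) simplicial_map_unit[OF pm pm automorphism_map[OF c'(1)]] by simp
    then show "L 1 (K 1 (unit M) (delta_edge 0 1)) (delta_edge 0 1) = unit M"
      using w(4) unfolding s_def by simp
  qed (use K0 K1 L0 L1 c' d' cin din in auto)
  show ?thesis
    by (rule bij_betw_byWitness[where f' = "\<lambda>u. L k u t"])
      (use KL LK cylinder_in[OF K _ t] cylinder_in[OF L _ t] in auto)
qed

section \<open>The bar construction\<close>

lemma aut_group_monoid:
  assumes "simplicial_set X"
  shows "monoid (aut_group X)"
proof
  fix f g h
  assume "f \<in> carrier (aut_group X)" "g \<in> carrier (aut_group X)" "h \<in> carrier (aut_group X)"
  then have fgh: "sset_iso X X f" "sset_iso X X g" "sset_iso X X h" by (auto simp: aut_group_def)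
  have in_X: "h n x \<in> simplices X n" "f n x \<in> simplices X n" if "x \<in> simplices X n" for n x
    using fgh that automorphism_sset_iso automorphism_map simplicial_map_in by metis+
  show "f \<otimes>\<^bsub>aut_group X\<^esub> g \<in> carrier (aut_group X)"
    using sset_iso_comp fgh by (simp add: aut_group_def)
  show "f \<otimes>\<^bsub>aut_group X\<^esub> g \<otimes>\<^bsub>aut_group X\<^esub> h = f \<otimes>\<^bsub>aut_group X\<^esub> (g \<otimes>\<^bsub>aut_group X\<^esub> h)"
    using in_X by (auto simp: aut_group_def sset_comp_def compose_def fun_eq_iff)
  have "f n x = undefined" if "x \<notin> simplices X n" for n x
    using sset_iso_extensional[OF fgh(1)] that by (auto simp: extensional_def)
  then show "\<one>\<^bsub>aut_group X\<^esub> \<otimes>\<^bsub>aut_group X\<^esub> f = f" "f \<otimes>\<^bsub>aut_group X\<^esub> \<one>\<^bsub>aut_group X\<^esub> = f"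
    using in_X by (auto simp: aut_group_def sset_comp_def sset_id_def compose_def fun_eq_iff)
qed (use assms sset_iso_id in \<open>simp add: aut_group_def\<close>)

context monoid
begin

abbreviation segment :: "'a list \<Rightarrow> nat \<Rightarrow> nat \<Rightarrow> 'a" where
  "segment gs i d \<equiv> foldl (\<otimes>) \<one> (take d (drop i gs))"

lemma foldl_mult_closed: "set gs \<subseteq> carrier G \<Longrightarrow> a \<in> carrier G \<Longrightarrow> foldl (\<otimes>) a gs \<in> carrier G"
  by (induction gs arbitrary: a) auto

lemma foldl_mult: "set gs \<subseteq> carrier G \<Longrightarrow> a \<in> carrier G \<Longrightarrow> foldl (\<otimes>) a gs = a \<otimes> foldl (\<otimes>) \<one> gs"
proof (induction gs arbitrary: a)
  case (Cons g gs)
  have "foldl (\<otimes>) (a \<otimes> g) gs = a \<otimes> g \<otimes> foldl (\<otimes>) \<one> gs"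
    by (rule Cons.IH) (use Cons.prems in auto)
  also have "\<dots> = a \<otimes> (g \<otimes> foldl (\<otimes>) \<one> gs)"
    using Cons.prems foldl_mult_closed[of gs \<one>] by (simp add: m_assoc)
  also have "g \<otimes> foldl (\<otimes>) \<one> gs = foldl (\<otimes>) (\<one> \<otimes> g) gs"
    using Cons.IH[of g] Cons.prems by (simp del: foldl_Cons)
  finally show ?case by simp
qed simp

lemma segment_closed: "set gs \<subseteq> carrier G \<Longrightarrow> segment gs i d \<in> carrier G"
  by (rule foldl_mult_closed) (auto dest: in_set_takeD in_set_dropD)

lemma segment_add:
  assumes "set gs \<subseteq> carrier G"
  shows "segment gs i (d + d') = segment gs i d \<otimes> segment gs (i + d) d'"
proof -
  have "set (take d' (drop (i + d) gs)) \<subseteq> carrier G"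
    using assms by (auto dest: in_set_takeD in_set_dropD)
  then show ?thesis
    using foldl_mult[OF _ segment_closed[OF assms]] by (simp add: take_add add.commute)
qed

lemma length_bar_act: "length (bar_act (\<otimes>) \<one> m n \<theta> gs) = m"
  by (simp add: bar_act_def)

lemma set_bar_act: "set gs \<subseteq> carrier G \<Longrightarrow> set (bar_act (\<otimes>) \<one> m n \<theta> gs) \<subseteq> carrier G"
  using segment_closed by (auto simp: bar_act_def)

text \<open>The blocks cut out by \<open>\<theta>\<close> are adjacent, so by associativity their
  products multiply to the product over their union. This is the functoriality of the bar
  construction.\<close>

lemma segment_bar_act:
  assumes gs: "set gs \<subseteq> carrier G" and \<theta>: "\<theta> \<in> delta m n"
  shows "i + d \<le> m \<Longrightarrow> segment (bar_act (\<otimes>) \<one> m n \<theta> gs) i d = segment gs (\<theta> i) (\<theta> (i + d) - \<theta> i)"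
proof (induction d)
  case (Suc d)
  have le: "\<theta> i \<le> \<theta> (i + d)" "\<theta> (i + d) \<le> \<theta> (Suc (i + d))"
    using delta_mono[OF \<theta>] Suc.prems by simp_all
  have "segment gs (\<theta> i) (\<theta> (Suc (i + d)) - \<theta> i) =
      segment gs (\<theta> i) (\<theta> (i + d) - \<theta> i) \<otimes> segment gs (\<theta> (i + d)) (\<theta> (Suc (i + d)) - \<theta> (i + d))"
  proof -
    have "\<theta> (i + d) - \<theta> i + (\<theta> (Suc (i + d)) - \<theta> (i + d)) = \<theta> (Suc (i + d)) - \<theta> i"
      "\<theta> i + (\<theta> (i + d) - \<theta> i) = \<theta> (i + d)"
      using le by simp_all
    with segment_add[OF gs, where i = "\<theta> i" and d = "\<theta> (i + d) - \<theta> i"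
        and d' = "\<theta> (Suc (i + d)) - \<theta> (i + d)"]
    show ?thesis by (simp only:)
  qed
  then show ?case
    using Suc length_bar_act[of m n \<theta> gs]
    by (simp add: take_Suc_conv_app_nth) (simp add: bar_act_def Suc_eq_plus1[symmetric])
qed simp

lemma bar_simplicial: "simplicial_set (bar G)"
  unfolding simplicial_set_def
proof (intro conjI allI ballI)
  fix m n \<theta> gs assume "\<theta> \<in> delta m n" "gs \<in> simplices (bar G) n"
  then show "sact (bar G) m n \<theta> gs \<in> simplices (bar G) m"
    using set_bar_act[of gs m n \<theta>] by (auto simp: bar_def length_bar_act)
next
  fix n gs assume gs: "gs \<in> simplices (bar G) n"
  then have "foldl (\<otimes>) \<one> (take (Suc 0) (drop i gs)) = gs ! i" if "i < n" for i
    using that by (simp add: bar_def take_Suc_conv_app_nth in_lists_conv_set del: Suc_0_eq_1)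
  then show "sact (bar G) n n (delta_id n) gs = gs"
    using gs by (intro nth_equalityI) (auto simp: bar_def bar_act_def)
next
  fix l m n \<alpha> \<theta> gs
  assume a: "\<alpha> \<in> delta l m" "\<theta> \<in> delta m n" "gs \<in> simplices (bar G) n"
  then have gs: "set gs \<subseteq> carrier G" by (auto simp: bar_def)
  show "sact (bar G) l n (compose {..l} \<theta> \<alpha>) gs = sact (bar G) l m \<alpha> (sact (bar G) m n \<theta> gs)"
  proof (rule nth_equalityI)
    fix i assume "i < length (sact (bar G) l n (compose {..l} \<theta> \<alpha>) gs)"
    then have i: "i < l" by (simp add: bar_def length_bar_act)
    then have le: "\<alpha> i \<le> \<alpha> (Suc i)" "\<alpha> (Suc i) \<le> m"
      using delta_mono[OF a(1)] delta_le[OF a(1)] by simp_all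
    then have "segment (bar_act (\<otimes>) \<one> m n \<theta> gs) (\<alpha> i) (\<alpha> (Suc i) - \<alpha> i) =
        segment gs (\<theta> (\<alpha> i)) (\<theta> (\<alpha> (Suc i)) - \<theta> (\<alpha> i))"
      using segment_bar_act[OF gs a(2), where i = "\<alpha> i" and d = "\<alpha> (Suc i) - \<alpha> i"] by simp
    with i show "sact (bar G) l n (compose {..l} \<theta> \<alpha>) gs ! i =
        sact (bar G) l m \<alpha> (sact (bar G) m n \<theta> gs) ! i"
      unfolding bar_def by (simp add: bar_act_def[of _ _ l] compose_apply Suc_eq_plus1[symmetric])
  qed (simp add: bar_def length_bar_act)
qed

end

lemma bar_nth:
  assumes "monoid G" "gs \<in> simplices (bar G) n" "i < n"
  shows "edge (bar G) n i (Suc i) gs = [gs ! i]"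
proof -
  interpret monoid G by fact
  have gs: "gs ! i \<in> carrier G" "i < length gs" using assms by (auto simp: bar_def)
  then have "take 1 (drop i gs) = [gs ! i]"
    using take_Suc_conv_app_nth[of 0 "drop i gs"] by simp
  then have "segment gs i 1 = gs ! i" using gs by simp
  moreover have "edge (bar G) n i (Suc i) gs = [segment gs i 1]"
    by (simp add: bar_def bar_act_def upt_rec)
  ultimately show ?thesis by simp
qed

text \<open>The fold starts at \<open>e\<close>, so for a general \<open>mul\<close> the factor
  \<open>e\<close> stays on the left; it disappears once a left unit law for \<open>mul\<close> is
  known.\<close>

lemma bar_act_pair:
  "bar_act mul e 1 2 (delta_edge 0 1) [a, b] = [mul e a]"
  "bar_act mul e 1 2 (delta_edge 1 2) [a, b] = [mul e b]"
  "bar_act mul e 1 2 (delta_edge 0 2) [a, b] = [mul (mul e a) b]"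
  by (simp_all add: bar_act_def upt_rec numeral_2_eq_2 del: Suc_0_eq_1) (simp_all add: One_nat_def del: Suc_0_eq_1)

section \<open>Regular trivializations\<close>

lemma simplicial_set_std_simplex: "simplicial_set (std_simplex n)"
  unfolding simplicial_set_def std_simplex_def by (auto simp: compose_delta_assoc)

lemma yoneda_hom:
  assumes X: "simplicial_set X" and b: "b \<in> simplices X n"
  shows "sset_hom (std_simplex n) X (\<lambda>k. \<lambda>t\<in>delta k n. sact X k n t b)"
  unfolding sset_hom_def
  using simplicial_set_std_simplex[of n] X b by (auto simp: std_simplex_def sact_sact)

section \<open>An extension with a regular section\<close>

locale regular_split =
  fixes M :: "'a sset" and E :: "'b sset" and H :: "'c sset"
    and \<iota> :: "nat \<Rightarrow> 'a \<Rightarrow> 'b" and \<tau> :: "nat \<Rightarrow> 'b \<Rightarrow> 'c" and \<sigma> :: "nat \<Rightarrow> 'c \<Rightarrow> 'b"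
  assumes is_extension: "extension M E H \<iota> \<tau>"
    and is_regular: "regular_section M E H \<iota> \<tau> \<sigma>"
begin

lemma M_group: "partial_group M" and M: "partial_monoid M" and H: "partial_monoid H"
  using is_extension unfolding extension_def partial_group_def by auto

lemmas M_simplicial = pm_simplicial[OF M] and H_simplicial = pm_simplicial[OF H]

lemma E_simplicial: "simplicial_set E"
  and \<tau>_map: "simplicial_map E H \<tau>"
  and \<tau>_surj: "\<tau> n ` simplices E n = simplices H n"
  using is_extension unfolding extension_def fibre_bundle_def
  by (auto intro: sset_hom_simplicial_map simp: sset_hom_def)

text \<open>The simplices of \<open>E\<close> over one \<open>k\<close>-simplex of \<open>H\<close>;
  the simplicial fibre \<open>sset_fibre\<close> over the vertex is recovered by taking
  \<open>x\<close> to be \<open>degen H k\<close>.\<close>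

definition fibre :: "nat \<Rightarrow> 'c \<Rightarrow> 'b set" where
  "fibre k x = {e \<in> simplices E k. \<tau> k e = x}"

lemma \<iota>_bij: "bij_betw (\<iota> k) (simplices M k) (fibre k (degen H k))"
  using is_extension unfolding extension_def sset_iso_def sset_fibre_def fibre_def degen_def by auto

lemma \<iota>_map: "simplicial_map M E \<iota>"
  using is_extension unfolding extension_def sset_iso_def sset_hom_def sset_fibre_def simplicial_map_def
  by (auto simp: Pi_iff PiE_iff)

lemma \<tau>_\<iota>: "u \<in> simplices M k \<Longrightarrow> \<tau> k (\<iota> k u) = degen H k"
  using \<iota>_bij[of k] unfolding bij_betw_def fibre_def by auto

lemma \<sigma>_map: "simplicial_map H E \<sigma>"
  using is_regular unfolding regular_section_def by (auto intro: sset_hom_simplicial_map)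

lemma \<tau>_\<sigma>: "b \<in> simplices H n \<Longrightarrow> \<tau> n (\<sigma> n b) = b"
proof -
  assume b: "b \<in> simplices H n"
  have "sset_comp H \<tau> \<sigma> n b = sset_id H n b"
    using is_regular unfolding regular_section_def by simp
  then show ?thesis using b by (simp add: sset_comp_def sset_id_def compose_eq)
qed

text \<open>The spine of a 1-simplex is that simplex itself, so membership of
  \<open>\<sigma> 1 g\<close> in the normalizer yields a single homotopy. By the convention for
  labels, \<open>\<iota>\<close> sits over the vertex 1 and its twist by \<open>c\<close> over the
  vertex 0.\<close>

lemma regularity:
  assumes g: "g \<in> simplices H 1"
  obtains c F where "sset_iso M M c" "cylinder_map M 1 E F"
    "\<And>k u. u \<in> simplices M k \<Longrightarrow> F k u (delta_const k 0) = \<iota> k (c k u)"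
    "\<And>k u. u \<in> simplices M k \<Longrightarrow> F k u (delta_const k 1) = \<iota> k u"
    "F 1 (unit M) (delta_edge 0 1) = \<sigma> 1 g"
proof -
  have "\<sigma> 1 g \<in> ext_normalizer M E \<iota> 1"
    using is_regular g unfolding regular_section_def by blast
  then obtain c where c: "sset_iso M M c" "homotopic_via M E (sset_comp M \<iota> c) (\<sigma> 1 g) \<iota>"
    using E_simplicial unfolding ext_normalizer_def aut_group_def by auto
  then obtain F where F: "sset_hom (sset_prod M (std_simplex 1)) E F"
    "sset_comp M \<iota> c = (\<lambda>n. \<lambda>y\<in>simplices M n. F n (y, delta_const n 0))"
    "\<iota> = (\<lambda>n. \<lambda>y\<in>simplices M n. F n (y, delta_const n 1))"
    "F 1 (unit M, delta_id 1) = \<sigma> 1 g"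
    unfolding homotopic_via_def by blast
  show ?thesis
  proof (rule that[OF c(1), of "\<lambda>k u t. F k (u, t)"])
    show "cylinder_map M 1 E (\<lambda>k u t. F k (u, t))"
      using F(1) unfolding cylinder_map_def sset_hom_def sset_prod_def std_simplex_def
      by (auto simp: PiE_iff Pi_iff)
    show "F k (u, delta_const k 0) = \<iota> k (c k u)" if "u \<in> simplices M k" for k u
      using fun_cong[OF fun_cong[OF F(2), of k], of u] that by (simp add: sset_comp_def compose_eq)
    show "F k (u, delta_const k 1) = \<iota> k u" if "u \<in> simplices M k" for k u
      using fun_cong[OF fun_cong[OF F(3), of k], of u] that by simp
  qed (use F(4) delta_id_1 in simp)
qed

text \<open>\<open>S k e t\<close> is the component in \<open>M\<close> of the trivialization of the
  bundle along the map \<open>\<Delta>[n] \<rightarrow> H\<close> given by \<open>b\<close>. The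
  other component is \<open>t\<close>, as the trivialization lies over \<open>\<Delta>[n]\<close>,
  so bijectivity holds for each \<open>t\<close> separately.\<close>

lemma local_trivialization:
  assumes b: "b \<in> simplices H n"
  obtains S where
    "\<And>k t. t \<in> delta k n \<Longrightarrow> bij_betw (\<lambda>e. S k e t) (fibre k (sact H k n t b)) (simplices M k)"
    "\<And>k l \<theta> t e. \<theta> \<in> delta k l \<Longrightarrow> t \<in> delta l n \<Longrightarrow> e \<in> fibre l (sact H l n t b) \<Longrightarrow>
       S k (sact E k l \<theta> e) (compose {..k} t \<theta>) = sact M k l \<theta> (S l e t)"
proof -
  let ?b = "\<lambda>k. \<lambda>t\<in>delta k n. sact H k n t b"
  define P where "P = sset_pullback E (std_simplex n) \<tau> ?b"
  define MD where "MD = sset_prod M (std_simplex n)"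
  have P: "simplices P k = {(e, t). t \<in> delta k n \<and> e \<in> fibre k (sact H k n t b)}" for k
    unfolding P_def sset_pullback_def std_simplex_def fibre_def by auto
  have MD: "simplices MD k = simplices M k \<times> delta k n" for k
    unfolding MD_def sset_prod_def std_simplex_def by simp
  have hom: "sset_hom (std_simplex n) H ?b" by (rule yoneda_hom[OF H_simplicial b])
  have triv: "\<forall>n b. sset_hom (std_simplex n) H b \<longrightarrow>
        (\<exists>\<psi>. sset_iso (sset_pullback E (std_simplex n) \<tau> b) (sset_prod M (std_simplex n)) \<psi> \<and>
             (\<forall>k. \<forall>p\<in>simplices (sset_pullback E (std_simplex n) \<tau> b) k. snd (\<psi> k p) = snd p))"
    using is_extension unfolding extension_def fibre_bundle_def by (elim conjE)
  obtain \<psi> where \<psi>: "sset_iso P (MD) \<psi>"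
    and snd: "\<And>k p. p \<in> simplices P k \<Longrightarrow> snd (\<psi> k p) = snd p"
    using triv[rule_format, OF hom, folded P_def MD_def] by blast
  have bij: "bij_betw (\<psi> k) (simplices P k) (simplices M k \<times> delta k n)" for k
    using \<psi> MD unfolding sset_iso_def by metis
  show ?thesis
  proof (rule that[of "\<lambda>k e t. fst (\<psi> k (e, t))"])
    fix k t assume t: "t \<in> delta k n"
    have in1: "(e, t) \<in> simplices P k" if "e \<in> fibre k (sact H k n t b)" for e
      using that t P by blast
    show "bij_betw (\<lambda>e. fst (\<psi> k (e, t))) (fibre k (sact H k n t b)) (simplices M k)"
      unfolding bij_betw_def
    proof (intro conjI inj_onI equalityI subsetI)
      fix e e' assume e: "e \<in> fibre k (sact H k n t b)" "e' \<in> fibre k (sact H k n t b)"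
        "fst (\<psi> k (e, t)) = fst (\<psi> k (e', t))"
      then have "\<psi> k (e, t) = \<psi> k (e', t)"
        using snd[OF in1] by (intro prod_eqI) auto
      then show "e = e'" using bij e in1 unfolding bij_betw_def inj_on_def by blast
    next
      fix u assume "u \<in> (\<lambda>e. fst (\<psi> k (e, t))) ` fibre k (sact H k n t b)"
      then obtain e where e: "e \<in> fibre k (sact H k n t b)" "u = fst (\<psi> k (e, t))" by blast
      show "u \<in> simplices M k"
        using bij_betw_apply[OF bij in1[OF e(1)]] e(2) by (simp add: mem_Times_iff)
    next
      fix u assume "u \<in> simplices M k"
      then have "(u, t) \<in> \<psi> k ` simplices P k" using bij[of k] t unfolding bij_betw_def by blast
      then obtain e t' where e: "(e, t') \<in> simplices P k" "\<psi> k (e, t') = (u, t)" by auto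
      then have "t' = t" using snd[OF e(1)] by simp
      then show "u \<in> (\<lambda>e. fst (\<psi> k (e, t))) ` fibre k (sact H k n t b)" using e P[of k] by force
    qed
  next
    fix k l \<theta> t e assume a: "\<theta> \<in> delta k l" "t \<in> delta l n" "e \<in> fibre l (sact H l n t b)"
    then have "(e, t) \<in> simplices P l" using P by blast
    then have "\<psi> k (sact P k l \<theta> (e, t)) = sact (MD) k l \<theta> (\<psi> l (e, t))"
      using \<psi> a(1) unfolding sset_iso_def sset_hom_def by blast
    then show "fst (\<psi> k (sact E k l \<theta> e, compose {..k} t \<theta>)) = sact M k l \<theta> (fst (\<psi> l (e, t)))"
      by (simp add: P_def MD_def sset_pullback_def sset_prod_def std_simplex_def split: prod.splits)
  qed
qed

lemma fibre_sact: "e \<in> fibre l x \<Longrightarrow> \<theta> \<in> delta k l \<Longrightarrow> sact E k l \<theta> e \<in> fibre k (sact H k l \<theta> x)"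
  unfolding fibre_def using E_simplicial simplicial_map_sact[OF \<tau>_map] by auto

text \<open>Simplices of \<open>E\<close> with equal spines have images in \<open>H\<close> with
  equal spines, hence the same image \<open>b\<close>. In a trivialization over \<open>b\<close>
  their components in \<open>M\<close> again have equal spines, so they coincide.\<close>

lemma E_monoid: "partial_monoid E"
proof -
  have eq: "x = y" if xy: "x \<in> simplices E n" "y \<in> simplices E n" "\<tau> n x = \<tau> n y"
    and s: "\<And>i. i < n \<Longrightarrow> edge E n i (Suc i) x = edge E n i (Suc i) y" for n x y
  proof -
    have b: "\<tau> n x \<in> simplices H n" using xy simplicial_map_in[OF \<tau>_map] by blast
    obtain S where S: "\<And>k t. t \<in> delta k n \<Longrightarrow>
        bij_betw (\<lambda>e. S k e t) (fibre k (sact H k n t (\<tau> n x))) (simplices M k)"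
      and S': "\<And>k l \<theta> t e. \<theta> \<in> delta k l \<Longrightarrow> t \<in> delta l n \<Longrightarrow> e \<in> fibre l (sact H l n t (\<tau> n x)) \<Longrightarrow>
       S k (sact E k l \<theta> e) (compose {..k} t \<theta>) = sact M k l \<theta> (S l e t)"
      using local_trivialization[OF b] by metis
    have f: "x \<in> fibre n (sact H n n (delta_id n) (\<tau> n x))"
      "y \<in> fibre n (sact H n n (delta_id n) (\<tau> n x))"
      using xy b H_simplicial unfolding fibre_def by auto
    have "S n x (delta_id n) = S n y (delta_id n)"
    proof (rule pm_eqI[OF M])
      fix i assume i: "i < n"
      show "edge M n i (Suc i) (S n x (delta_id n)) = edge M n i (Suc i) (S n y (delta_id n))"
        using S'[OF _ delta_id_in f(1), of "delta_edge i (Suc i)" 1, symmetric]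
          S'[OF _ delta_id_in f(2), of "delta_edge i (Suc i)" 1, symmetric] i s by simp
    qed (use S[OF delta_id_in] f in \<open>auto dest: bij_betw_apply\<close>)
    then show ?thesis using S[OF delta_id_in] f unfolding bij_betw_def inj_on_def by blast
  qed
  have "\<exists>!v. v \<in> simplices E 0"
  proof -
    have "simplices E 0 \<noteq> {}" using \<tau>_surj[of 0] pm_vertex[OF H] by auto
    moreover have "\<tau> 0 v = vertex H" if "v \<in> simplices E 0" for v
      using pm_vertex_unique[OF H simplicial_map_in[OF \<tau>_map that]] .
    ultimately show ?thesis using eq[of _ 0] by (metis equals0I not_less0)
  qed
  moreover have "inj_on (spine E n) (simplices E n)" for n
  proof (rule inj_onI)
    fix x y assume xy: "x \<in> simplices E n" "y \<in> simplices E n" "spine E n x = spine E n y"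
    have s: "edge E n i (Suc i) x = edge E n i (Suc i) y" if "i < n" for i
      using xy(3) nth_spine[OF that, of E] by metis
    have "\<tau> n x = \<tau> n y"
    proof (rule pm_eqI[OF H])
      fix i assume "i < n"
      then show "edge H n i (Suc i) (\<tau> n x) = edge H n i (Suc i) (\<tau> n y)"
        using simplicial_map_edge[OF \<tau>_map, symmetric] s xy by simp
    qed (use xy simplicial_map_in[OF \<tau>_map] in auto)
    then show "x = y" using eq xy s by blast
  qed
  ultimately show ?thesis unfolding partial_monoid_def using E_simplicial by blast
qed

text \<open>\<open>cylinder_unique\<close> is applied in \<open>H\<close>, to \<open>\<tau>\<close>
  after \<open>G\<close> and to the map that sends \<open>(u, t)\<close> to
  \<open>sact H k n t b\<close>.\<close>

lemma cylinder_over: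
  assumes G: "cylinder_map M n E G" and b: "b \<in> simplices H n"
    and c: "\<And>x i. x \<in> simplices M 1 \<Longrightarrow> i \<le> n \<Longrightarrow> \<tau> 1 (G 1 x (delta_const 1 i)) = unit H"
    and e: "\<And>i j. i < j \<Longrightarrow> j \<le> n \<Longrightarrow> \<tau> 1 (G 1 (unit M) (delta_edge i j)) = edge H n i j b"
    and u: "u \<in> simplices M k" and t: "t \<in> delta k n"
  shows "G k u t \<in> fibre k (sact H k n t b)"
proof -
  have "cylinder_map M n H (\<lambda>k u t. sact H k n t b)"
    unfolding cylinder_map_def using H_simplicial b by (auto simp: sact_sact)
  then have "\<tau> k (G k u t) = sact H k n t b"
  proof (rule cylinder_unique[OF M H cylinder_post[OF G \<tau>_map] _ _ _ u t])
    show "\<tau> 1 (G 1 x (delta_const 1 i)) = sact H 1 n (delta_const 1 i) b"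
      if "x \<in> simplices M 1" "i \<le> n" for x i using c edge_const[OF H b] that by simp
    show "\<tau> 1 (G 1 (unit M) (delta_edge i j)) = edge H n i j b"
      if "i \<le> j" "j \<le> n" for i j
      using c[OF unit_in[OF M], of i] e[of i j] edge_const[OF H b] that by (cases "i = j") auto
  qed
  then show ?thesis unfolding fibre_def using cylinder_in[OF G u t] by simp
qed

section \<open>Gluing homotopies to a trivialization adapted to the section\<close>

lemma fibre_const: "b \<in> simplices H n \<Longrightarrow> i \<le> n \<Longrightarrow> fibre k (sact H k n (delta_const k i) b) = fibre k (degen H k)"
  by (simp add: sact_const[OF H])

lemma \<sigma>_edge_fibre:
  assumes "b \<in> simplices H n" "i \<le> j" "j \<le> n"
  shows "\<sigma> 1 (edge H n i j b) \<in> fibre 1 (edge H n i j b)"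
proof -
  have "edge H n i j b \<in> simplices H 1" using assms H_simplicial by simp
  then show ?thesis unfolding fibre_def using \<tau>_\<sigma> simplicial_map_in[OF \<sigma>_map] by simp
qed

text \<open>Read in a trivialization \<open>S\<close> over \<open>b\<close>, the homotopies over the edges of the spine of \<open>b\<close>
  are homotopies between automorphisms of \<open>M\<close>. Pulled back along the collapses
  \<open>\<Delta>[n] \<rightarrow> \<Delta>[1]\<close> they are composed one after the other; \<open>A\<close> is what has been obtained from the
  first \<open>j\<close> edges and is constant beyond the vertex \<open>j\<close>.\<close>

definition glued_upto ::
  "'c \<Rightarrow> nat \<Rightarrow> (nat \<Rightarrow> 'b \<Rightarrow> (nat \<Rightarrow> nat) \<Rightarrow> 'a) \<Rightarrow> nat \<Rightarrow>
    (nat \<Rightarrow> 'a \<Rightarrow> (nat \<Rightarrow> nat) \<Rightarrow> 'a) \<Rightarrow> (nat \<Rightarrow> nat \<Rightarrow> 'a \<Rightarrow> 'a) \<Rightarrow> bool" where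
  "glued_upto b n S j A c \<longleftrightarrow> cylinder_map M n M A \<and>
    (\<forall>k. \<forall>t\<in>delta k n. bij_betw (\<lambda>u. A k u t) (simplices M k) (simplices M k)) \<and>
    (\<forall>i\<le>j. automorphism M (c i) \<and>
      (\<forall>k. \<forall>u\<in>simplices M k. A k u (delta_const k i) = S k (\<iota> k (c i k u)) (delta_const k i))) \<and>
    (\<forall>k. \<forall>u\<in>simplices M k. c 0 k u = u) \<and>
    (\<forall>i<j. A 1 (unit M) (delta_edge i (Suc i)) =
      S 1 (\<sigma> 1 (edge H n i (Suc i) b)) (delta_edge i (Suc i))) \<and>
    (\<forall>k. \<forall>u\<in>simplices M k. \<forall>t\<in>delta k n. A k u (\<lambda>l\<in>{..k}. min j (t l)) = A k u t)"

lemma regular_gluing: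
  fixes S
  assumes b: "b \<in> simplices H n"
    and S: "\<And>k t. t \<in> delta k n \<Longrightarrow>
      bij_betw (\<lambda>e. S k e t) (fibre k (sact H k n t b)) (simplices M k)"
    and S_sact: "\<And>k l \<theta> t e. \<theta> \<in> delta k l \<Longrightarrow> t \<in> delta l n \<Longrightarrow> e \<in> fibre l (sact H l n t b) \<Longrightarrow>
       S k (sact E k l \<theta> e) (compose {..k} t \<theta>) = sact M k l \<theta> (S l e t)"
    and j: "j \<le> n"
  shows "\<exists>A c. glued_upto b n S j A c"
  using j
proof (induction j)
  have S_in: "S k e t \<in> simplices M k" if "t \<in> delta k n" "e \<in> fibre k (sact H k n t b)" for k e t
    using bij_betw_apply[OF S that(2)] that(1) by simp
  define \<psi> where "\<psi> i k u = S k (\<iota> k u) (delta_const k i)" for i k u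
  have \<iota>_in: "\<iota> k u \<in> fibre k (sact H k n (delta_const k i) b)" if "u \<in> simplices M k" "i \<le> n" for k u i
    using bij_betw_apply[OF \<iota>_bij that(1)] fibre_const[OF b that(2)] by simp
  \<comment> \<open>\<open>\<psi> i\<close> is \<open>\<iota>\<close> over the vertex
    \<open>i\<close>, read in \<open>S\<close>. Over that vertex \<open>\<iota>\<close> is a
    bijection onto the fibre and \<open>S\<close> one from the fibre to \<open>M\<close>.\<close>
  have \<psi>: "automorphism M (\<psi> i)" if i: "i \<le> n" for i
    unfolding automorphism_def simplicial_map_def
  proof safe
    fix k u assume "u \<in> simplices M k"
    then show "\<psi> i k u \<in> simplices M k" unfolding \<psi>_def using S_in \<iota>_in i by simp
  next
    fix k l \<theta> u assume "\<theta> \<in> delta k l" "u \<in> simplices M l"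
    then show "\<psi> i k (sact M k l \<theta> u) = sact M k l \<theta> (\<psi> i l u)"
      unfolding \<psi>_def using S_sact[of \<theta> k l "delta_const l i" "\<iota> l u"] \<iota>_in i
      by (simp add: simplicial_map_sact[OF \<iota>_map])
  next
    fix k
    have "bij_betw (\<lambda>e. S k e (delta_const k i)) (fibre k (degen H k)) (simplices M k)"
      using S[of "delta_const k i" k] fibre_const[OF b i] i by simp
    from bij_betw_trans[OF \<iota>_bij this] show "bij_betw (\<psi> i k) (simplices M k) (simplices M k)"
      by (simp add: \<psi>_def[abs_def] comp_def)
  qed
  {
    case 0
    show ?case unfolding glued_upto_def
    \<comment> \<open>For \<open>j = 0\<close> the cylinder is constant and all automorphisms are
      the identity, which also fixes the normalization over the vertex 0.\<close>
    proof (intro exI[of _ "\<lambda>k u t. \<psi> 0 k u"] exI[of _ "\<lambda>i k u. u"] conjI)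
      show "cylinder_map M n M (\<lambda>k u t. \<psi> 0 k u)"
        by (rule cylinder_fst[OF automorphism_map[OF \<psi>]]) simp
      show "\<forall>k. \<forall>t\<in>delta k n. bij_betw (\<lambda>u. \<psi> 0 k u) (simplices M k) (simplices M k)"
        using automorphism_bij[OF \<psi>[of 0]] by simp
    qed (auto simp: automorphism_id \<psi>_def)
  next
    case (Suc j)
    then obtain A c where IH: "glued_upto b n S j A c" by auto
    have A: "cylinder_map M n M A"
      and A_bij: "\<And>k t. t \<in> delta k n \<Longrightarrow> bij_betw (\<lambda>u. A k u t) (simplices M k) (simplices M k)"
      and c: "\<And>i. i \<le> j \<Longrightarrow> automorphism M (c i)"
      and Ac: "\<And>i k u. i \<le> j \<Longrightarrow> u \<in> simplices M k \<Longrightarrow> A k u (delta_const k i) = \<psi> i k (c i k u)"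
      and c0: "\<And>k u. u \<in> simplices M k \<Longrightarrow> c 0 k u = u"
      and Ae: "\<And>i. i < j \<Longrightarrow> A 1 (unit M) (delta_edge i (Suc i)) =
        S 1 (\<sigma> 1 (edge H n i (Suc i) b)) (delta_edge i (Suc i))"
      and A_min: "\<And>k u t. u \<in> simplices M k \<Longrightarrow> t \<in> delta k n \<Longrightarrow>
        A k u (\<lambda>l\<in>{..k}. min j (t l)) = A k u t"
      using IH unfolding glued_upto_def \<psi>_def by simp_all
    have jn: "j \<le> n" "Suc j \<le> n" using Suc by auto
    define g where "g = edge H n j (Suc j) b"
    define \<epsilon> where "\<epsilon> = delta_edge j (Suc j)"
    have \<epsilon>: "\<epsilon> \<in> delta 1 n" unfolding \<epsilon>_def using jn by simp
    have g: "g \<in> simplices H 1" unfolding g_def using b jn H_simplicial by simp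
    obtain c' F where c': "sset_iso M M c'" and F: "cylinder_map M 1 E F"
      and F0: "\<And>k u. u \<in> simplices M k \<Longrightarrow> F k u (delta_const k 0) = \<iota> k (c' k u)"
      and F1: "\<And>k u. u \<in> simplices M k \<Longrightarrow> F k u (delta_const k 1) = \<iota> k u"
      and Fe: "F 1 (unit M) (delta_edge 0 1) = \<sigma> 1 g"
      using regularity[OF g] by metis
    have c'_aut: "automorphism M c'"
      using c' sset_hom_simplicial_map unfolding automorphism_def sset_iso_def by blast
    obtain c'' where c'': "automorphism M c''"
      "\<And>k u. u \<in> simplices M k \<Longrightarrow> c' k (c'' k u) = u"
      using automorphism_inverse[OF M_simplicial c'_aut] by metis
    have aut_jj: "automorphism M (\<lambda>k u. \<psi> j k (c j k u))"
      by (rule automorphism_comp[OF c[OF le_refl] \<psi>[OF jn(1)]])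
    \<comment> \<open>\<open>B\<close> undoes what \<open>A\<close> does over the vertex
      \<open>j\<close>.\<close>
    obtain B where B: "automorphism M B"
      "\<And>k u. u \<in> simplices M k \<Longrightarrow> \<psi> j k (c j k (B k u)) = u"
      "\<And>k u. u \<in> simplices M k \<Longrightarrow> B k (\<psi> j k (c j k u)) = u"
      using automorphism_inverse[OF M_simplicial aut_jj] by metis
    \<comment> \<open>\<open>D\<close> is chosen so that the homotopy, preceded by \<open>D\<close>,
      starts over its vertex 0 with \<open>c j\<close>, where \<open>A\<close> ends. It becomes the
      automorphism over the vertex \<open>j + 1\<close>.\<close>
    define D where "D k u = c'' k (c j k u)" for k u
    have D: "automorphism M D" unfolding D_def by (rule automorphism_comp[OF c[OF le_refl] c''(1)])
    have c'D: "c' k (D k u) = c j k u" if "u \<in> simplices M k" for k u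
      unfolding D_def using c''(2) simplicial_map_in[OF automorphism_map[OF c]] that by simp
    note D_in = simplicial_map_in[OF automorphism_map[OF D]]
    note \<psi>_in = simplicial_map_in[OF automorphism_map[OF \<psi>]]
    \<comment> \<open>The collapse of \<open>\<Delta>[n]\<close> onto \<open>\<Delta>[1]\<close>
      that contracts the vertices up to \<open>j\<close> to 0 and the later ones to 1.\<close>
    define q where "q = (\<lambda>l\<in>{..n}. if l \<le> j then 0 else 1::nat)"
    have q: "q \<in> delta n 1" unfolding q_def by (intro deltaI) auto
    have q_apply: "q i = (if i \<le> j then 0 else 1)" if "i \<le> n" for i
      using that by (simp add: q_def)
    \<comment> \<open>The homotopy \<open>F\<close>, placed over the edge from \<open>j\<close> to
      \<open>j + 1\<close> of \<open>b\<close> and read in \<open>S\<close>.\<close>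
    define K where "K k u s = S k (F k u s) (compose {..k} \<epsilon> s)" for k u s
    have F_fibre: "F k u s \<in> fibre k (sact H k n (compose {..k} \<epsilon> s) b)"
      if "u \<in> simplices M k" "s \<in> delta k 1" for k u s
    proof -
      have "F k u s \<in> fibre k (sact H k 1 s g)"
      proof (rule cylinder_over[OF F g _ _ that])
        fix x and i :: nat assume x: "x \<in> simplices M 1" "i \<le> 1"
        then have "i = 0 \<or> i = 1" by linarith
        then show "\<tau> 1 (F 1 x (delta_const 1 i)) = unit H"
          using F0 F1 \<tau>_\<iota> x simplicial_map_in[OF automorphism_map[OF c'_aut]] unit_degen by metis
      next
        fix i j :: nat assume "i < j" "j \<le> 1"
        then have "i = 0" "j = 1" by linarith+
        then show "\<tau> 1 (F 1 (unit M) (delta_edge i j)) = edge H 1 i j g"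
          using Fe \<tau>_\<sigma>[OF g] g H_simplicial by simp
      qed
      then show ?thesis
        using sact_sact[OF H_simplicial that(2) \<epsilon> b] unfolding g_def \<epsilon>_def by simp
    qed
    have K: "cylinder_map M 1 M K"
      unfolding cylinder_map_def
    proof safe
      fix k u s assume "u \<in> simplices M k" "s \<in> delta k 1"
      then show "K k u s \<in> simplices M k" unfolding K_def using S_in F_fibre \<epsilon> by simp
    next
      fix k l \<theta> u s assume a: "\<theta> \<in> delta k l" "u \<in> simplices M l" "s \<in> delta l 1"
      have "compose {..k} \<epsilon> (compose {..k} s \<theta>) = compose {..k} (compose {..l} \<epsilon> s) \<theta>"
        using compose_delta_assoc[OF a(1)] by metis
      then show "K k (sact M k l \<theta> u) (compose {..k} s \<theta>) = sact M k l \<theta> (K l u s)"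
        unfolding K_def using S_sact[OF a(1) _ F_fibre[OF a(2,3)]] cylinder_sact[OF F a] a(3) \<epsilon> by simp
    qed
    have K0: "K k u (delta_const k 0) = \<psi> j k (c' k u)"
      and K1: "K k u (delta_const k 1) = \<psi> (Suc j) k u" if "u \<in> simplices M k" for k u
      unfolding K_def \<psi>_def \<epsilon>_def using F0 F1 that by simp_all
    \<comment> \<open>Here the inversion of \<open>M\<close> enters: a homotopy between
      automorphisms of a partial group is bijective over every simplex of
      \<open>\<Delta>[1]\<close>, not only over the two vertices.\<close>
    have K_bij: "bij_betw (\<lambda>u. K k u s) (simplices M k) (simplices M k)" if "s \<in> delta k 1" for k s
      by (rule cylinder_map_bij[OF M_group K automorphism_comp[OF c'_aut \<psi>[OF jn(1)]] \<psi>[OF jn(2)] _ _ that])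
        (use K0 K1 in auto)
    \<comment> \<open>Over the vertices up to \<open>j\<close> the inserted map \<open>B K D\<close>
      is the identity, because \<open>K\<close> is there \<open>\<psi> j\<close> after
      \<open>c'\<close> and \<open>c' D = c j\<close>; so \<open>A'\<close> agrees with
      \<open>A\<close>. From \<open>j\<close> onwards \<open>A\<close> is constant by
      \<open>A_min\<close> and cancels \<open>B\<close>, which leaves \<open>K D\<close>.\<close>
    define A' where "A' k u t = A k (B k (K k (D k u) (compose {..k} q t))) t" for k u t
    have "cylinder_map M n M (\<lambda>k u t. B k (K k (D k u) (compose {..k} q t)))"
      using cylinder_post[OF cylinder_pull[OF q cylinder_pre[OF automorphism_map[OF D] K]]
        automorphism_map[OF B(1)]] .
    then have "cylinder_map M n M A'"
      unfolding A'_def using cylinder_comp A by fast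
    moreover have "bij_betw (\<lambda>u. A' k u t) (simplices M k) (simplices M k)" if t: "t \<in> delta k n" for k t
    proof -
      have "compose {..k} q t \<in> delta k 1" using t q by simp
      from bij_betw_trans[OF bij_betw_trans[OF bij_betw_trans[OF automorphism_bij[OF D] K_bij[OF this]]
            automorphism_bij[OF B(1)]] A_bij[OF t]]
      show ?thesis unfolding A'_def by (simp add: comp_def)
    qed
    moreover define c1 where "c1 i = (if i \<le> j then c i else D)" for i
    have "automorphism M (c1 i)" for i unfolding c1_def using c D by simp
    moreover have "A' k u (delta_const k i) = S k (\<iota> k (c1 i k u)) (delta_const k i)"
      if i: "i \<le> Suc j" and u: "u \<in> simplices M k" for i k u
    proof (cases "i \<le> j")
      case True
      then have "compose {..k} q (delta_const k i) = delta_const k 0" using q_apply jn by simp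
      then show ?thesis
        unfolding A'_def c1_def using K0[OF D_in[OF u]] c'D[OF u] B(3)[OF u] Ac[OF True u] True
        by (simp add: \<psi>_def)
    next
      case False
      then have i: "i = Suc j" using i by simp
      have "compose {..k} q (delta_const k i) = delta_const k 1" using q_apply jn i by simp
      moreover have "(\<lambda>l\<in>{..k}. min j (delta_const k i l)) = delta_const k j"
        unfolding delta_const_def i by (auto simp: fun_eq_iff)
      moreover have v: "\<psi> (Suc j) k (D k u) \<in> simplices M k" using \<psi>_in[OF jn(2)] D_in u by simp
      ultimately show ?thesis
        unfolding A'_def c1_def
        using K1[OF D_in[OF u]] A_min[of "B k (\<psi> (Suc j) k (D k u))" k "delta_const k i"] False
          Ac[of j "B k (\<psi> (Suc j) k (D k u))" k] B(2)[OF v] simplicial_map_in[OF automorphism_map[OF B(1)] v] jn i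
        by (simp add: \<psi>_def)
    qed
    moreover have "c1 0 k u = u" if "u \<in> simplices M k" for k u
      unfolding c1_def using c0 that by simp
    moreover have "A' 1 (unit M) (delta_edge i (Suc i)) =
      S 1 (\<sigma> 1 (edge H n i (Suc i) b)) (delta_edge i (Suc i))" if i: "i < Suc j" for i
    proof (cases "i < j")
      case True
      then have "compose {..1} q (delta_edge i (Suc i)) = delta_const 1 0" using q_apply jn by simp
      then show ?thesis
        unfolding A'_def
        using K0[OF D_in[OF unit_in[OF M]]] c'D[OF unit_in[OF M]] B(3)[OF unit_in[OF M]] Ae[OF True]
        by simp
    next
      case False
      then have i: "i = j" using i by simp
      have "compose {..1} q (delta_edge i (Suc i)) = delta_edge 0 1" using q_apply jn i by simp
      moreover have "D 1 (unit M) = unit M"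
        by (rule simplicial_map_unit[OF M M automorphism_map[OF D]])
      moreover define x where "x = K 1 (unit M) (delta_edge 0 1)"
      moreover have x: "x \<in> simplices M 1" unfolding x_def by (rule cylinder_in[OF K]) (use M in auto)
      then have "B 1 x \<in> simplices M 1" using simplicial_map_in[OF automorphism_map[OF B(1)]] by simp
      then have "A 1 (B 1 x) (delta_edge j (Suc j)) = A 1 (B 1 x) (\<lambda>l\<in>{..1}. min j (delta_edge j (Suc j) l))"
        using A_min jn by simp
      moreover have "(\<lambda>l\<in>{..1}. min j (delta_edge j (Suc j) l)) = delta_const 1 j"
        by (auto simp: fun_eq_iff delta_edge_def delta_const_def)
      ultimately have "A' 1 (unit M) (delta_edge i (Suc i)) = x"
        unfolding A'_def using Ac[OF le_refl \<open>B 1 x \<in> simplices M 1\<close>] B(2)[OF x] i by simp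
      then show ?thesis unfolding x_def K_def \<epsilon>_def using Fe i g_def by simp
    qed
    moreover have "A' k u (\<lambda>l\<in>{..k}. min (Suc j) (t l)) = A' k u t"
      if u: "u \<in> simplices M k" and t: "t \<in> delta k n" for k u t
    proof -
      let ?t = "\<lambda>l\<in>{..k}. min (Suc j) (t l)"
      have t': "?t \<in> delta k n"
        by (rule deltaI) (use delta_le[OF t] delta_mono[OF t] in \<open>auto simp: min_def le_Suc_eq intro: order_trans\<close>)
      \<comment> \<open>Cutting off at \<open>j + 1\<close> changes neither which vertices are at
        most \<open>j\<close> nor the cut-off at \<open>j\<close>, and \<open>A'\<close> depends on
        \<open>t\<close> only through these two.\<close>
      have "compose {..k} q ?t = compose {..k} q t"
        using delta_le[OF t] delta_le[OF t'] q_apply by (auto simp: fun_eq_iff compose_def)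
      moreover have "(\<lambda>l\<in>{..k}. min j (?t l)) = (\<lambda>l\<in>{..k}. min j (t l))"
        by (auto simp: fun_eq_iff)
      moreover have "B k (K k (D k u) (compose {..k} q t)) \<in> simplices M k"
        using simplicial_map_in[OF automorphism_map[OF B(1)]] cylinder_in[OF K] D_in u q t by simp
      ultimately show ?thesis unfolding A'_def using A_min[OF _ t] A_min[OF _ t'] by metis
    qed
    ultimately have "glued_upto b n S (Suc j) A' c1" unfolding glued_upto_def by blast
    then show ?case by blast
  }
qed

text \<open>\<open>G\<close> is the inverse of \<open>S\<close> after the glued self-map of
  \<open>M \<times> \<Delta>[n]\<close> for \<open>j = n\<close>. Since the latter was prescribed in
  terms of \<open>S\<close>, the auxiliary trivialization cancels on the vertices and on the spine
  of \<open>b\<close>.\<close>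

lemma regular_trivialization:
  assumes b: "b \<in> simplices H n"
  obtains G c where "cylinder_map M n E G"
    "\<And>k t. t \<in> delta k n \<Longrightarrow> bij_betw (\<lambda>u. G k u t) (simplices M k) (fibre k (sact H k n t b))"
    "\<And>i. i \<le> n \<Longrightarrow> automorphism M (c i)"
    "\<And>i k u. i \<le> n \<Longrightarrow> u \<in> simplices M k \<Longrightarrow> G k u (delta_const k i) = \<iota> k (c i k u)"
    "\<And>k u. u \<in> simplices M k \<Longrightarrow> c 0 k u = u"
    "\<And>k t. t \<in> delta k n \<Longrightarrow> G k (degen M k) t = sact E k n t (\<sigma> n b)"
proof -
  obtain S where S: "\<And>k t. t \<in> delta k n \<Longrightarrow>
      bij_betw (\<lambda>e. S k e t) (fibre k (sact H k n t b)) (simplices M k)"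
    and S_sact: "\<And>k l \<theta> t e. \<theta> \<in> delta k l \<Longrightarrow> t \<in> delta l n \<Longrightarrow> e \<in> fibre l (sact H l n t b) \<Longrightarrow>
       S k (sact E k l \<theta> e) (compose {..k} t \<theta>) = sact M k l \<theta> (S l e t)"
    using local_trivialization[OF b] by metis
  define T where "T k u t = inv_into (fibre k (sact H k n t b)) (\<lambda>e. S k e t) u" for k u t
  have T: "bij_betw (\<lambda>u. T k u t) (simplices M k) (fibre k (sact H k n t b))"
    if "t \<in> delta k n" for k t
    unfolding T_def by (rule bij_betw_inv_into[OF S[OF that]])
  have TS: "T k (S k e t) t = e" if "t \<in> delta k n" "e \<in> fibre k (sact H k n t b)" for k e t
    unfolding T_def using bij_betw_inv_into_left[OF S[OF that(1)] that(2)] .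
  have ST: "S k (T k u t) t = u" if "t \<in> delta k n" "u \<in> simplices M k" for k u t
    unfolding T_def using bij_betw_inv_into_right[OF S[OF that(1)] that(2)] .
  have T_in: "T k u t \<in> fibre k (sact H k n t b)" if "t \<in> delta k n" "u \<in> simplices M k" for k u t
    using bij_betw_apply[OF T[OF that(1)] that(2)] .
  have T_cyl: "cylinder_map M n E T"
    unfolding cylinder_map_def
  proof safe
    fix k u t assume "u \<in> simplices M k" "t \<in> delta k n"
    then show "T k u t \<in> simplices E k" using T_in unfolding fibre_def by blast
  next
    fix k l \<theta> u t assume a: "\<theta> \<in> delta k l" "u \<in> simplices M l" "t \<in> delta l n"
    have t: "compose {..k} t \<theta> \<in> delta k n" using a by simp
    have "sact E k l \<theta> (T l u t) \<in> fibre k (sact H k n (compose {..k} t \<theta>) b)"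
      using fibre_sact[OF T_in[OF a(3,2)] a(1)] sact_sact[OF H_simplicial a(1,3) b] by simp
    from TS[OF t this] show "T k (sact M k l \<theta> u) (compose {..k} t \<theta>) = sact E k l \<theta> (T l u t)"
      using S_sact[OF a(1,3) T_in[OF a(3,2)]] ST[OF a(3,2)] by simp
  qed
  obtain A c where glued: "glued_upto b n S n A c"
    using regular_gluing[of b n S n, OF b S S_sact] by blast
  have A: "cylinder_map M n M A"
    and A_bij: "\<And>k t. t \<in> delta k n \<Longrightarrow> bij_betw (\<lambda>u. A k u t) (simplices M k) (simplices M k)"
    and c: "\<And>i. i \<le> n \<Longrightarrow> automorphism M (c i)"
    and Ac: "\<And>i k u. i \<le> n \<Longrightarrow> u \<in> simplices M k \<Longrightarrow>
      A k u (delta_const k i) = S k (\<iota> k (c i k u)) (delta_const k i)"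
    and c0: "\<And>k u. u \<in> simplices M k \<Longrightarrow> c 0 k u = u"
    and Ae: "\<And>i. i < n \<Longrightarrow> A 1 (unit M) (delta_edge i (Suc i)) =
        S 1 (\<sigma> 1 (edge H n i (Suc i) b)) (delta_edge i (Suc i))"
    using glued unfolding glued_upto_def by simp_all
  define G where "G k u t = T k (A k u t) t" for k u t
  have G: "cylinder_map M n E G" unfolding G_def by (rule cylinder_comp[OF A T_cyl])
  have Ge: "G 1 (unit M) (delta_edge i (Suc i)) = \<sigma> 1 (edge H n i (Suc i) b)" if i: "i < n" for i
    unfolding G_def Ae[OF i] by (rule TS) (use i \<sigma>_edge_fibre[OF b, of i "Suc i"] in auto)
  have \<sigma>b: "\<sigma> n b \<in> simplices E n" using simplicial_map_in[OF \<sigma>_map b] .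
  \<comment> \<open>The gluing prescribes only the edges between consecutive vertices; as
    \<open>E\<close> is a partial monoid, these determine the whole simplex
    \<open>\<sigma> n b\<close>.\<close>
  have Gid: "G n (degen M n) (delta_id n) = \<sigma> n b"
  proof (rule pm_eqI[OF E_monoid])
    show "G n (degen M n) (delta_id n) \<in> simplices E n" by (rule cylinder_in[OF G]) (use M in auto)
    fix i assume i: "i < n"
    then have "edge M n i (Suc i) (degen M n) = unit M"
      unfolding unit_degen by (intro sact_degen[OF M]) simp
    then show "edge E n i (Suc i) (G n (degen M n) (delta_id n)) = edge E n i (Suc i) (\<sigma> n b)"
      using cylinder_edge[OF G degen_in[OF M] delta_id_in, of i "Suc i"] i Ge[OF i]
        simplicial_map_edge[OF \<sigma>_map _ _ b, of i "Suc i"] by simp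
  qed (rule \<sigma>b)
  show ?thesis
  proof (rule that[of G c, OF G _ c _ c0])
    show "bij_betw (\<lambda>u. G k u t) (simplices M k) (fibre k (sact H k n t b))"
      if "t \<in> delta k n" for k t
      using bij_betw_trans[OF A_bij[OF that] T[OF that]] unfolding G_def by (simp add: comp_def)
    show "G k u (delta_const k i) = \<iota> k (c i k u)" if i: "i \<le> n" and u: "u \<in> simplices M k" for i k u
    proof -
      have "c i k u \<in> simplices M k" using simplicial_map_in[OF automorphism_map[OF c[OF i]] u] .
      then have "\<iota> k (c i k u) \<in> fibre k (sact H k n (delta_const k i) b)"
        using bij_betw_apply[OF \<iota>_bij] fibre_const[OF b i] by blast
      then show ?thesis unfolding G_def Ac[OF i u] using TS i by simp
    qed
    show "G k (degen M k) t = sact E k n t (\<sigma> n b)" if t: "t \<in> delta k n" for k t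
      using cylinder_sact[OF G t degen_in[OF M] delta_id_in] Gid sact_degen[OF M t] t by simp
  qed
qed

section \<open>Coordinates\<close>

text \<open>The forced value of \<open>\<phi>\<close> on \<open>(x, g)\<close>.\<close>

definition glue :: "'a \<Rightarrow> 'c \<Rightarrow> 'b" where
  "glue x g = pprod E [\<iota> 1 x, \<sigma> 1 g]"

lemma glue_eq:
  "w \<in> simplices E 2 \<Longrightarrow> edge E 2 0 1 w = \<iota> 1 x \<Longrightarrow> edge E 2 1 2 w = \<sigma> 1 g \<Longrightarrow> glue x g = edge E 2 0 2 w"
  unfolding glue_def using pprod_triangle[OF E_monoid, of w] by simp

text \<open>The two factorizations of a diagonal edge, with the values of \<open>G\<close> over
  vertices and on base edges put in. Together they say \<open>\<sigma>(g) \<cdot> \<iota>(c j x) =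
  \<iota>(c i x) \<cdot> \<sigma>(g)\<close>, where \<open>g\<close> is the edge of \<open>b\<close>
  from \<open>i\<close> to \<open>j\<close>.\<close>

lemma trivialization_glue:
  assumes G: "cylinder_map M n E G" and b: "b \<in> simplices H n"
    and c: "\<And>i u. i \<le> n \<Longrightarrow> u \<in> simplices M 1 \<Longrightarrow> G 1 u (delta_const 1 i) = \<iota> 1 (c i 1 u)"
    and \<sigma>: "\<And>t. t \<in> delta 1 n \<Longrightarrow> G 1 (unit M) t = sact E 1 n t (\<sigma> n b)"
    and x: "x \<in> simplices M 1" "i \<le> j" "j \<le> n"
  shows "\<exists>w\<in>simplices E 2. edge E 2 0 1 w = \<iota> 1 (c i 1 x) \<and> edge E 2 1 2 w = \<sigma> 1 (edge H n i j b) \<and>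
      edge E 2 0 2 w = G 1 x (delta_edge i j)"
    and "\<exists>w\<in>simplices E 2. edge E 2 0 1 w = \<sigma> 1 (edge H n i j b) \<and> edge E 2 1 2 w = \<iota> 1 (c j 1 x) \<and>
      edge E 2 0 2 w = G 1 x (delta_edge i j)"
    and "G 1 x (delta_edge i j) = glue (c i 1 x) (edge H n i j b)"
proof -
  have e: "G 1 (unit M) (delta_edge i j) = \<sigma> 1 (edge H n i j b)"
    by (rule trans[OF \<sigma>[OF delta_edge_in[OF x(2,3)]] simplicial_map_edge[OF \<sigma>_map x(2,3) b, symmetric]])
  show "\<exists>w\<in>simplices E 2. edge E 2 0 1 w = \<sigma> 1 (edge H n i j b) \<and> edge E 2 1 2 w = \<iota> 1 (c j 1 x) \<and>
      edge E 2 0 2 w = G 1 x (delta_edge i j)"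
    by (rule cylinder_edge_right[OF M G x]) (use c[OF x(3,1)] e in auto)
  show w: "\<exists>w\<in>simplices E 2. edge E 2 0 1 w = \<iota> 1 (c i 1 x) \<and> edge E 2 1 2 w = \<sigma> 1 (edge H n i j b) \<and>
      edge E 2 0 2 w = G 1 x (delta_edge i j)"
    by (rule cylinder_edge_left[OF M G x]) (use c[OF order_trans[OF x(2,3)] x(1)] e in auto)
  then show "G 1 x (delta_edge i j) = glue (c i 1 x) (edge H n i j b)" using glue_eq by metis
qed

text \<open>In the adapted trivialization over \<open>g\<close> the automorphism over the vertex 0
  is the identity, so \<open>glue x g\<close> is the value of \<open>G\<close> on \<open>x\<close>
  and the full edge.\<close>

lemma glue_bij:
  assumes g: "g \<in> simplices H 1"
  shows "bij_betw (\<lambda>x. glue x g) (simplices M 1) (fibre 1 g)"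
proof -
  obtain G c where G: "cylinder_map M 1 E G"
    "\<And>k t. t \<in> delta k 1 \<Longrightarrow> bij_betw (\<lambda>u. G k u t) (simplices M k) (fibre k (sact H k 1 t g))"
    "\<And>i. i \<le> 1 \<Longrightarrow> automorphism M (c i)"
    and c: "\<And>i k u. i \<le> 1 \<Longrightarrow> u \<in> simplices M k \<Longrightarrow> G k u (delta_const k i) = \<iota> k (c i k u)"
    "\<And>k u. u \<in> simplices M k \<Longrightarrow> c 0 k u = u"
    and \<sigma>: "\<And>k t. t \<in> delta k 1 \<Longrightarrow> G k (degen M k) t = sact E k 1 t (\<sigma> 1 g)"
    by (rule regular_trivialization[OF g], rule that; assumption)
  have g01: "edge H 1 0 1 g = g" using g H_simplicial by simp
  note j = trivialization_glue[of 1 G g c, OF G(1) g c(1) \<sigma>[of _ 1, folded unit_degen], of _ 0 1]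
  have Gj: "G 1 x (delta_edge 0 1) = glue x g" if "x \<in> simplices M 1" for x
    using j(3)[OF _ _ _ that] c(2)[OF that] g01 by simp
  have "bij_betw (\<lambda>x. G 1 x (delta_edge 0 1)) (simplices M 1) (fibre 1 g)"
    using G(2)[of "delta_edge 0 1" 1] g01 by simp
  then show "bij_betw (\<lambda>x. glue x g) (simplices M 1) (fibre 1 g)"
    using bij_betw_cong[of "simplices M 1" "\<lambda>x. glue x g"] Gj by metis
qed

lemma glue_inj:
  "g \<in> simplices H 1 \<Longrightarrow> x \<in> simplices M 1 \<Longrightarrow> y \<in> simplices M 1 \<Longrightarrow> glue x g = glue y g \<Longrightarrow> x = y"
  using glue_bij[of g] unfolding bij_betw_def inj_on_def by blast

lemma glue_in: "g \<in> simplices H 1 \<Longrightarrow> x \<in> simplices M 1 \<Longrightarrow> glue x g \<in> fibre 1 g"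
  using bij_betw_apply[OF glue_bij] .

text \<open>The automorphism \<open>c\<close> with \<open>\<sigma>(g) \<cdot> \<iota>(x) = \<iota>(c x) \<cdot> \<sigma>(g)\<close>.\<close>

definition conj_aut :: "'c \<Rightarrow> nat \<Rightarrow> 'a \<Rightarrow> 'a" where
  "conj_aut g = (SOME c. sset_iso M M c \<and> (\<forall>x\<in>simplices M 1. \<exists>w\<in>simplices E 2.
     edge E 2 0 1 w = \<sigma> 1 g \<and> edge E 2 1 2 w = \<iota> 1 x \<and> edge E 2 0 2 w = glue (c 1 x) g))"

lemma
  assumes g: "g \<in> simplices H 1"
  shows conj_aut_iso: "sset_iso M M (conj_aut g)"
    and conj_aut_ex: "x \<in> simplices M 1 \<Longrightarrow> \<exists>w\<in>simplices E 2.
     edge E 2 0 1 w = \<sigma> 1 g \<and> edge E 2 1 2 w = \<iota> 1 x \<and> edge E 2 0 2 w = glue (conj_aut g 1 x) g"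
proof -
  obtain c F where c: "sset_iso M M c" and F: "cylinder_map M 1 E F"
    and F0: "\<And>k u. u \<in> simplices M k \<Longrightarrow> F k u (delta_const k 0) = \<iota> k (c k u)"
    and F1: "\<And>k u. u \<in> simplices M k \<Longrightarrow> F k u (delta_const k 1) = \<iota> k u"
    and Fe: "F 1 (unit M) (delta_edge 0 1) = \<sigma> 1 g"
    using regularity[OF g] by metis
  have "\<exists>w\<in>simplices E 2. edge E 2 0 1 w = \<sigma> 1 g \<and> edge E 2 1 2 w = \<iota> 1 x \<and> edge E 2 0 2 w = glue (c 1 x) g"
    if x: "x \<in> simplices M 1" for x
  proof -
    obtain v where v: "v \<in> simplices E 2" "edge E 2 0 1 v = \<iota> 1 (c 1 x)" "edge E 2 1 2 v = \<sigma> 1 g"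
      "edge E 2 0 2 v = F 1 x (delta_edge 0 1)"
      using cylinder_edge_left[OF M F x, of 0 1] F0[OF x] Fe by auto
    obtain w where w: "w \<in> simplices E 2" "edge E 2 0 1 w = \<sigma> 1 g" "edge E 2 1 2 w = \<iota> 1 x"
      "edge E 2 0 2 w = F 1 x (delta_edge 0 1)"
      using cylinder_edge_right[OF M F x, of 0 1] F1[OF x] Fe by auto
    show ?thesis using w v(4) glue_eq[OF v(1-3)] by (intro bexI[of _ w]) auto
  qed
  with c have "\<exists>c. sset_iso M M c \<and> (\<forall>x\<in>simplices M 1. \<exists>w\<in>simplices E 2.
     edge E 2 0 1 w = \<sigma> 1 g \<and> edge E 2 1 2 w = \<iota> 1 x \<and> edge E 2 0 2 w = glue (c 1 x) g)"
    by blast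
  from someI_ex[OF this, folded conj_aut_def]
  show "sset_iso M M (conj_aut g)"
    and "x \<in> simplices M 1 \<Longrightarrow> \<exists>w\<in>simplices E 2.
     edge E 2 0 1 w = \<sigma> 1 g \<and> edge E 2 1 2 w = \<iota> 1 x \<and> edge E 2 0 2 w = glue (conj_aut g 1 x) g"
    by blast+
qed

lemma conj_aut_in: "g \<in> simplices H 1 \<Longrightarrow> x \<in> simplices M 1 \<Longrightarrow> conj_aut g 1 x \<in> simplices M 1"
  using simplicial_map_in automorphism_map automorphism_sset_iso conj_aut_iso by metis

lemma glue_conj_aut:
  assumes g: "g \<in> simplices H 1" and x: "x \<in> simplices M 1" and w: "w \<in> simplices E 2"
    "edge E 2 0 1 w = \<sigma> 1 g" "edge E 2 1 2 w = \<iota> 1 x"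
  shows "glue (conj_aut g 1 x) g = edge E 2 0 2 w"
  using conj_aut_ex[OF g x] pm_triangle_eq[OF E_monoid w(1)] w by metis

text \<open>\<open>glue\<close> is injective for fixed \<open>g\<close>, so the conjugation relation
  determines the value; in degree 1 \<open>conj_aut\<close> is thus independent of the choice in its
  definition.\<close>

lemma conj_aut_unique:
  assumes g: "g \<in> simplices H 1" and x: "x \<in> simplices M 1" and y: "y \<in> simplices M 1"
    and w: "w \<in> simplices E 2" "edge E 2 0 1 w = \<sigma> 1 g" "edge E 2 1 2 w = \<iota> 1 x" "edge E 2 0 2 w = glue y g"
  shows "conj_aut g 1 x = y"
  using glue_inj[OF g conj_aut_in[OF g x] y] glue_conj_aut[OF g x w(1-3)] w(4) by simp

text \<open>The last property compares the two triangles of \<open>trivialization_glue\<close> by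
  means of \<open>conj_aut_unique\<close>. For \<open>i = 0\<close> it says that \<open>c j\<close>
  is inverse, in degree 1, to conjugation by the edge of \<open>b\<close> from 0 to
  \<open>j\<close>.\<close>

lemma conj_trivialization:
  assumes b: "b \<in> simplices H n"
  obtains G c where "cylinder_map M n E G"
    "bij_betw (\<lambda>u. G n u (delta_id n)) (simplices M n) (fibre n b)"
    "\<And>i. i \<le> n \<Longrightarrow> automorphism M (c i)"
    "\<And>x. x \<in> simplices M 1 \<Longrightarrow> c 0 1 x = x"
    "\<And>i j x. i \<le> j \<Longrightarrow> j \<le> n \<Longrightarrow> x \<in> simplices M 1 \<Longrightarrow>
      G 1 x (delta_edge i j) = glue (c i 1 x) (edge H n i j b)"
    "\<And>i j x. i \<le> j \<Longrightarrow> j \<le> n \<Longrightarrow> x \<in> simplices M 1 \<Longrightarrow>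
      conj_aut (edge H n i j b) 1 (c j 1 x) = c i 1 x"
proof -
  obtain G c where G: "cylinder_map M n E G"
    "\<And>k t. t \<in> delta k n \<Longrightarrow> bij_betw (\<lambda>u. G k u t) (simplices M k) (fibre k (sact H k n t b))"
    "\<And>i. i \<le> n \<Longrightarrow> automorphism M (c i)"
    and c: "\<And>i k u. i \<le> n \<Longrightarrow> u \<in> simplices M k \<Longrightarrow> G k u (delta_const k i) = \<iota> k (c i k u)"
    "\<And>k u. u \<in> simplices M k \<Longrightarrow> c 0 k u = u"
    and \<sigma>: "\<And>k t. t \<in> delta k n \<Longrightarrow> G k (degen M k) t = sact E k n t (\<sigma> n b)"
    by (rule regular_trivialization[OF b], rule that; assumption)
  note j = trivialization_glue[of n G b c, OF G(1) b c(1) \<sigma>[of _ 1, folded unit_degen]]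
  show ?thesis
  proof (rule that[of G c, OF G(1) _ G(3) c(2)])
    show "bij_betw (\<lambda>u. G n u (delta_id n)) (simplices M n) (fibre n b)"
      using G(2)[of "delta_id n" n] b H_simplicial by simp
    show "G 1 x (delta_edge i i') = glue (c i 1 x) (edge H n i i' b)"
      if "i \<le> i'" "i' \<le> n" "x \<in> simplices M 1" for i i' x
      using j(3) that by blast
    show "conj_aut (edge H n i i' b) 1 (c i' 1 x) = c i 1 x"
      if i: "i \<le> i'" "i' \<le> n" and x: "x \<in> simplices M 1" for i i' x
    proof -
      have c_in: "c i 1 x \<in> simplices M 1" "c i' 1 x \<in> simplices M 1"
        using simplicial_map_in[OF automorphism_map[OF G(3)] x] i by auto
      have g: "edge H n i i' b \<in> simplices H 1" using i b H_simplicial by simp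
      obtain w where "w \<in> simplices E 2" "edge E 2 0 1 w = \<sigma> 1 (edge H n i i' b)"
        "edge E 2 1 2 w = \<iota> 1 (c i' 1 x)" "edge E 2 0 2 w = G 1 x (delta_edge i i')"
        using j(2)[OF _ _ _ x i] by auto
      then show ?thesis using j(3)[OF _ _ _ x i] conj_aut_unique[OF g c_in(2,1)] by simp
    qed
  qed simp
qed

text \<open>Write \<open>g_ij\<close> for the edges of \<open>w\<close>. Conjugation by
  \<open>g_12\<close> takes \<open>c 2\<close> to \<open>c 1\<close>, and by \<open>g_01\<close>
  takes \<open>c 1\<close> to \<open>c 0\<close>; conjugation by \<open>g_02\<close> takes
  \<open>c 2\<close> to \<open>c 0\<close> at once. As \<open>c 2\<close> is surjective, this gives
  the claim in degree 1, which is enough.\<close>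

lemma conj_aut_mult:
  assumes w: "w \<in> simplices H 2"
  shows "sset_comp M (conj_aut (edge H 2 0 1 w)) (conj_aut (edge H 2 1 2 w)) = conj_aut (edge H 2 0 2 w)"
proof (rule sset_iso_eqI[OF M])
  have e: "edge H 2 0 1 w \<in> simplices H 1" "edge H 2 1 2 w \<in> simplices H 1" "edge H 2 0 2 w \<in> simplices H 1"
    using w H_simplicial by auto
  show "sset_iso M M (sset_comp M (conj_aut (edge H 2 0 1 w)) (conj_aut (edge H 2 1 2 w)))"
    "sset_iso M M (conj_aut (edge H 2 0 2 w))"
    using conj_aut_iso e sset_iso_comp by blast+
  fix x assume x: "x \<in> simplices M 1"
  obtain G c where "cylinder_map M 2 E G" and aut: "\<And>i. i \<le> 2 \<Longrightarrow> automorphism M (c i)"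
    and c: "\<And>i j x. i \<le> j \<Longrightarrow> j \<le> 2 \<Longrightarrow> x \<in> simplices M 1 \<Longrightarrow>
      conj_aut (edge H 2 i j w) 1 (c j 1 x) = c i 1 x"
    by (rule conj_trivialization[OF w], rule that; assumption)
  obtain y where y: "y \<in> simplices M 1" "x = c 2 1 y"
    using automorphism_bij[OF aut[of 2], of 1] x unfolding bij_betw_def by auto
  show "sset_comp M (conj_aut (edge H 2 0 1 w)) (conj_aut (edge H 2 1 2 w)) 1 x = conj_aut (edge H 2 0 2 w) 1 x"
    using x c[of 0 2, OF _ _ y(1)] c[of 1 2, OF _ _ y(1)] c[of 0 1, OF _ _ y(1)] y(2)
    by (simp add: sset_comp_def compose_eq)
qed

lemma conj_aut_unit: "conj_aut (unit H) = sset_id M"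
proof (rule sset_iso_eqI[OF M])
  show "sset_iso M M (conj_aut (unit H))" using conj_aut_iso unit_in[OF H] .
  show "sset_iso M M (sset_id M)" using sset_iso_id M_simplicial .
  fix x assume x: "x \<in> simplices M 1"
  obtain w where w: "w \<in> simplices E 2" "edge E 2 0 1 w = unit E" "edge E 2 1 2 w = \<iota> 1 x"
    "edge E 2 0 2 w = \<iota> 1 x"
    using unit_left[OF E_monoid simplicial_map_in[OF \<iota>_map x]] .
  obtain v where v: "v \<in> simplices E 2" "edge E 2 0 1 v = \<iota> 1 x" "edge E 2 1 2 v = unit E"
    "edge E 2 0 2 v = \<iota> 1 x"
    using unit_right[OF E_monoid simplicial_map_in[OF \<iota>_map x]] .
  have u: "\<sigma> 1 (unit H) = unit E" by (rule simplicial_map_unit[OF H E_monoid \<sigma>_map])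
  have "glue x (unit H) = \<iota> 1 x" using glue_eq[of v x "unit H"] u v by simp
  then show "conj_aut (unit H) 1 x = sset_id M 1 x"
    using conj_aut_unique[OF unit_in[OF H] x x w(1)] w u x by (simp add: sset_id_def)
qed

lemma glue_unit_right: "x \<in> simplices M 1 \<Longrightarrow> glue x (unit H) = \<iota> 1 x"
proof -
  assume x: "x \<in> simplices M 1"
  obtain v where v: "v \<in> simplices E 2" "edge E 2 0 1 v = \<iota> 1 x" "edge E 2 1 2 v = unit E"
    "edge E 2 0 2 v = \<iota> 1 x"
    using unit_right[OF E_monoid simplicial_map_in[OF \<iota>_map x]] .
  then show ?thesis
    using glue_eq[of v x "unit H"] simplicial_map_unit[OF H E_monoid \<sigma>_map] by simp
qed

lemma glue_unit_left: "g \<in> simplices H 1 \<Longrightarrow> glue (unit M) g = \<sigma> 1 g"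
proof -
  assume g: "g \<in> simplices H 1"
  obtain v where v: "v \<in> simplices E 2" "edge E 2 0 1 v = unit E" "edge E 2 1 2 v = \<sigma> 1 g"
    "edge E 2 0 2 v = \<sigma> 1 g"
    using unit_left[OF E_monoid simplicial_map_in[OF \<sigma>_map g]] .
  then show ?thesis
    using glue_eq[of v "unit M" g] simplicial_map_unit[OF M E_monoid \<iota>_map] by simp
qed

section \<open>The homomorphism to the bar construction of the automorphism group\<close>

definition conj_hom :: "nat \<Rightarrow> 'c \<Rightarrow> (nat \<Rightarrow> 'a \<Rightarrow> 'a) list" where
  "conj_hom n = (\<lambda>b\<in>simplices H n. map conj_aut (spine H n b))"

lemma conj_hom_hom: "sset_hom H (bar (aut_group M)) conj_hom"
  unfolding sset_hom_def
proof safe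
  show "simplicial_set H" by (rule H_simplicial)
  show "simplicial_set (bar (aut_group M))"
    using monoid.bar_simplicial aut_group_monoid M_simplicial by blast
  show "conj_hom n b \<in> simplices (bar (aut_group M)) n" if b: "b \<in> simplices H n" for n b
    using spine_in[OF H_simplicial b] b
    by (auto simp: conj_hom_def bar_def aut_group_def intro!: conj_aut_iso)
  show "conj_hom n b = undefined" if "b \<notin> simplices H n" for n b
    using that by (simp add: conj_hom_def)
  show "conj_hom m (sact H m n \<theta> b) = sact (bar (aut_group M)) m n \<theta> (conj_hom n b)"
    if \<theta>: "\<theta> \<in> delta m n" and b: "b \<in> simplices H n" for m n \<theta> b
    using bar_act_spine[OF H, of conj_aut "\<one>\<^bsub>aut_group M\<^esub>" "mult (aut_group M)", OF _ _ b \<theta>]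
      conj_aut_unit conj_aut_mult b \<theta> H_simplicial
    by (simp add: conj_hom_def bar_def aut_group_def)
qed

lemma sd_action_conj_hom: "g \<in> simplices H 1 \<Longrightarrow> sd_action conj_hom g x = conj_aut g 1 x"
  by (simp add: sd_action_def conj_hom_def H_simplicial)

section \<open>Coordinates on \<open>E\<close>, inverse to \<open>glue\<close>\<close>

definition coords :: "'b \<Rightarrow> 'a \<times> 'c" where
  "coords z = (inv_into (simplices M 1) (\<lambda>x. glue x (\<tau> 1 z)) z, \<tau> 1 z)"

lemma coords_glue:
  assumes "x \<in> simplices M 1" "g \<in> simplices H 1"
  shows "coords (glue x g) = (x, g)"
proof -
  have "\<tau> 1 (glue x g) = g" using glue_in assms unfolding fibre_def by simp
  then show ?thesis
    unfolding coords_def using bij_betw_inv_into_left[OF glue_bij[OF assms(2)] assms(1)] by simp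
qed

lemma glue_cases:
  assumes "z \<in> simplices E 1"
  obtains x g where "x \<in> simplices M 1" "g \<in> simplices H 1" "z = glue x g"
proof -
  have g: "\<tau> 1 z \<in> simplices H 1" using simplicial_map_in[OF \<tau>_map assms] .
  have "z \<in> fibre 1 (\<tau> 1 z)" using assms unfolding fibre_def by simp
  then show ?thesis using glue_bij[OF g] g that unfolding bij_betw_def by blast
qed

lemma coords_inj: "inj_on coords (simplices E 1)"
  by (rule inj_onI) (metis coords_glue glue_cases prod.inject)

lemma coords_in: "z \<in> simplices E 1 \<Longrightarrow> coords z \<in> simplices M 1 \<times> simplices H 1"
  using glue_cases coords_glue by (metis SigmaI)

definition coord_list :: "nat \<Rightarrow> 'b \<Rightarrow> ('a \<times> 'c) list" where
  "coord_list n e = map coords (spine E n e)"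

lemma coord_list_length [simp]: "length (coord_list n e) = n"
  by (simp add: coord_list_def)

lemma coords_trivialization:
  assumes G: "cylinder_map M n E G" and b: "b \<in> simplices H n"
    and c: "\<And>i. i \<le> n \<Longrightarrow> automorphism M (c i)"
    and Gj: "\<And>i j x. i \<le> j \<Longrightarrow> j \<le> n \<Longrightarrow> x \<in> simplices M 1 \<Longrightarrow>
      G 1 x (delta_edge i j) = glue (c i 1 x) (edge H n i j b)"
    and u: "u \<in> simplices M n" and ij: "i \<le> j" "j \<le> n"
  shows "coords (edge E n i j (G n u (delta_id n))) = (c i 1 (edge M n i j u), edge H n i j b)"
proof -
  have e: "edge M n i j u \<in> simplices M 1" "edge H n i j b \<in> simplices H 1"
    using u b ij M_simplicial H_simplicial by auto
  have "c i 1 (edge M n i j u) \<in> simplices M 1"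
    using simplicial_map_in[OF automorphism_map[OF c]] e ij by simp
  then show ?thesis
    using cylinder_edge[OF G u delta_id_in ij] Gj[OF ij e(1)] e(2) coords_glue ij by simp
qed

text \<open>Let \<open>w = G u\<close> in the adapted trivialization over \<open>\<tau> w\<close>.
  The first coordinates of the three edges are \<open>u_01\<close>, \<open>c 1 u_12\<close> and
  \<open>u_02\<close>. The action of the first edge of \<open>b\<close> removes \<open>c 1\<close>,
  and what remains is the triangle \<open>u\<close> in \<open>M\<close>.\<close>

lemma coords_mult:
  assumes w: "w \<in> simplices E 2"
  shows "sd_mult M H conj_hom (coords (edge E 2 0 1 w)) (coords (edge E 2 1 2 w)) = coords (edge E 2 0 2 w)"
proof -
  define b where "b = \<tau> 2 w"
  have b: "b \<in> simplices H 2" unfolding b_def using simplicial_map_in[OF \<tau>_map w] .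
  obtain G c where G: "cylinder_map M 2 E G"
    and bij: "bij_betw (\<lambda>u. G 2 u (delta_id 2)) (simplices M 2) (fibre 2 b)"
    and c: "\<And>i. i \<le> 2 \<Longrightarrow> automorphism M (c i)"
    and c0: "\<And>x. x \<in> simplices M 1 \<Longrightarrow> c 0 1 x = x"
    and Gj: "\<And>i j x. i \<le> j \<Longrightarrow> j \<le> 2 \<Longrightarrow> x \<in> simplices M 1 \<Longrightarrow>
      G 1 x (delta_edge i j) = glue (c i 1 x) (edge H 2 i j b)"
    and cc: "\<And>i j x. i \<le> j \<Longrightarrow> j \<le> 2 \<Longrightarrow> x \<in> simplices M 1 \<Longrightarrow>
      conj_aut (edge H 2 i j b) 1 (c j 1 x) = c i 1 x"
    by (rule conj_trivialization[OF b], rule that; assumption)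
  have "w \<in> fibre 2 b" using w unfolding fibre_def b_def by simp
  then obtain u where u: "u \<in> simplices M 2" "w = G 2 u (delta_id 2)"
    using bij unfolding bij_betw_def by auto
  note co = coords_trivialization[OF G b c Gj u(1), folded u(2)]
  have e: "edge M 2 0 1 u \<in> simplices M 1" "edge M 2 1 2 u \<in> simplices M 1" "edge M 2 0 2 u \<in> simplices M 1"
    "edge H 2 0 1 b \<in> simplices H 1"
    using u b M_simplicial H_simplicial by auto
  show ?thesis
    using co[of 0 1] co[of 1 2] co[of 0 2] c0 cc[of 0 1 "edge M 2 1 2 u"] e
      pprod_triangle[OF M u(1)] pprod_triangle[OF H b]
    by (simp add: sd_mult_def sd_action_conj_hom)
qed

lemma coords_unit: "coords (unit E) = (unit M, unit H)"
proof -
  have "glue (unit M) (unit H) = unit E"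
    using glue_unit_right[OF unit_in[OF M]] simplicial_map_unit[OF M E_monoid \<iota>_map] by simp
  then show ?thesis using coords_glue[OF unit_in[OF M] unit_in[OF H]] by simp
qed

lemma coord_list_sact:
  "e \<in> simplices E n \<Longrightarrow> \<theta> \<in> delta m n \<Longrightarrow>
    coord_list m (sact E m n \<theta> e) = sact (semidirect M H conj_hom) m n \<theta> (coord_list n e)"
  unfolding coord_list_def semidirect_def
  using bar_act_spine[OF E_monoid, of coords, OF coords_unit coords_mult] by simp

text \<open>With \<open>e = G u\<close> for the trivialization \<open>G\<close> over \<open>\<tau> e\<close>, the \<open>i\<close>-th entry of the spine of \<open>e\<close>
  has the coordinates \<open>c\<^sub>i u\<^sub>i\<close> and \<open>g\<^sub>i\<close>, where \<open>c\<^sub>i\<close> is inverse to the action of \<open>g\<^sub>1\<cdots>g\<^sub>i\<close>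
  (counting from 0); so untwisting the list of coordinates gives \<open>u\<close>.\<close>

lemma coord_list_bij: "bij_betw (coord_list n) (simplices E n) (simplices (semidirect M H conj_hom) n)"
  unfolding bij_betw_def
proof
  show "inj_on (coord_list n) (simplices E n)"
  proof (rule inj_onI)
    fix e e' assume e: "e \<in> simplices E n" "e' \<in> simplices E n" "coord_list n e = coord_list n e'"
    show "e = e'"
    proof (rule pm_eqI[OF E_monoid e(1,2)])
      fix i assume i: "i < n"
      have "coords (edge E n i (Suc i) e) = coords (edge E n i (Suc i) e')"
        using arg_cong[OF e(3), of "\<lambda>l. l ! i"] i by (simp add: coord_list_def)
      then show "edge E n i (Suc i) e = edge E n i (Suc i) e'"
        using coords_inj e E_simplicial i unfolding inj_on_def by simp
    qed
  qed
  have main: "coord_list n (G n u (delta_id n)) = zs"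
    if G: "cylinder_map M n E G" and b: "b \<in> simplices H n"
      and c: "\<And>i. i \<le> n \<Longrightarrow> automorphism M (c i)"
      and Gj: "\<And>i j x. i \<le> j \<Longrightarrow> j \<le> n \<Longrightarrow> x \<in> simplices M 1 \<Longrightarrow>
        G 1 x (delta_edge i j) = glue (c i 1 x) (edge H n i j b)"
      and u: "u \<in> simplices M n"
      and zs: "length zs = n" "\<And>i. i < n \<Longrightarrow> zs ! i = (c i 1 (edge M n i (Suc i) u), edge H n i (Suc i) b)"
    for G b c u zs
    using zs coords_trivialization[OF G b c Gj u]
    by (intro nth_equalityI) (auto simp: coord_list_def)
  show "coord_list n ` simplices E n = simplices (semidirect M H conj_hom) n"
  proof (intro equalityI subsetI)
    fix zs assume "zs \<in> coord_list n ` simplices E n"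
    then obtain e where e: "e \<in> simplices E n" "zs = coord_list n e" by blast
    define b where "b = \<tau> n e"
    have b: "b \<in> simplices H n" unfolding b_def using simplicial_map_in[OF \<tau>_map e(1)] .
    obtain G c where G: "cylinder_map M n E G"
      and bij: "bij_betw (\<lambda>u. G n u (delta_id n)) (simplices M n) (fibre n b)"
      and c: "\<And>i. i \<le> n \<Longrightarrow> automorphism M (c i)"
      and c0: "\<And>x. x \<in> simplices M 1 \<Longrightarrow> c 0 1 x = x"
      and Gj: "\<And>i j x. i \<le> j \<Longrightarrow> j \<le> n \<Longrightarrow> x \<in> simplices M 1 \<Longrightarrow>
        G 1 x (delta_edge i j) = glue (c i 1 x) (edge H n i j b)"
      and cc: "\<And>i j x. i \<le> j \<Longrightarrow> j \<le> n \<Longrightarrow> x \<in> simplices M 1 \<Longrightarrow>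
        conj_aut (edge H n i j b) 1 (c j 1 x) = c i 1 x"
      by (rule conj_trivialization[OF b], rule that; assumption)
    have "e \<in> fibre n b" using e unfolding fibre_def b_def by simp
    then obtain u where u: "u \<in> simplices M n" "e = G n u (delta_id n)"
      using bij unfolding bij_betw_def by auto
    have nth: "zs ! i = (c i 1 (edge M n i (Suc i) u), edge H n i (Suc i) b)" if "i < n" for i
      using coords_trivialization[OF G b c Gj u(1), of i "Suc i", folded u(2)] that e(2)
      by (simp add: coord_list_def)
    have len: "length zs = n" using e(2) by simp
    have snd: "map snd zs = spine H n b" using nth len by (intro nth_equalityI) auto
    have fst: "sd_twist H conj_hom zs = spine M n u"
    proof (rule nth_equalityI)
      fix i assume "i < length (sd_twist H conj_hom zs)"
      then have i: "i < n" using len by (simp add: sd_twist_def)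
      have e: "edge M n i (Suc i) u \<in> simplices M 1" "edge H n 0 i b \<in> simplices H 1"
        using u b i M_simplicial H_simplicial by auto
      have "sd_twist H conj_hom zs ! i =
          sd_action conj_hom (pprod H (take i (spine H n b))) (c i 1 (edge M n i (Suc i) u))"
        using i len nth snd by (simp add: sd_twist_def)
      also have "\<dots> = conj_aut (edge H n 0 i b) 1 (c i 1 (edge M n i (Suc i) u))"
        using pprod_take_spine[OF H b, of i] i sd_action_conj_hom[OF e(2)] by simp
      also have "\<dots> = edge M n i (Suc i) u" using cc[of 0 i, OF _ _ e(1)] c0[OF e(1)] i by simp
      finally show "sd_twist H conj_hom zs ! i = spine M n u ! i" using i by simp
    qed (simp add: sd_twist_def len)
    have "set zs \<subseteq> simplices M 1 \<times> simplices H 1"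
    proof
      fix z assume "z \<in> set zs"
      then obtain y where y: "y \<in> set (spine E n e)" "z = coords y"
        using e(2) by (auto simp: coord_list_def)
      then show "z \<in> simplices M 1 \<times> simplices H 1"
        using coords_in[OF subsetD[OF spine_in[OF E_simplicial e(1)] y(1)]] by simp
    qed
    then show "zs \<in> simplices (semidirect M H conj_hom) n"
      using len snd fst b u(1) by (auto simp: semidirect_def words_def)
  next
    fix zs assume "zs \<in> simplices (semidirect M H conj_hom) n"
    then obtain b u where zs: "set zs \<subseteq> simplices M 1 \<times> simplices H 1" "length zs = n"
      and b: "b \<in> simplices H n" "map snd zs = spine H n b"
      and u: "u \<in> simplices M n" "sd_twist H conj_hom zs = spine M n u"
      by (auto simp: semidirect_def words_def)
    obtain G c where G: "cylinder_map M n E G"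
      and bij: "bij_betw (\<lambda>u. G n u (delta_id n)) (simplices M n) (fibre n b)"
      and c: "\<And>i. i \<le> n \<Longrightarrow> automorphism M (c i)"
      and c0: "\<And>x. x \<in> simplices M 1 \<Longrightarrow> c 0 1 x = x"
      and Gj: "\<And>i j x. i \<le> j \<Longrightarrow> j \<le> n \<Longrightarrow> x \<in> simplices M 1 \<Longrightarrow>
        G 1 x (delta_edge i j) = glue (c i 1 x) (edge H n i j b)"
      and cc: "\<And>i j x. i \<le> j \<Longrightarrow> j \<le> n \<Longrightarrow> x \<in> simplices M 1 \<Longrightarrow>
        conj_aut (edge H n i j b) 1 (c j 1 x) = c i 1 x"
      by (rule conj_trivialization[OF b(1)], rule that; assumption)
    have nth: "zs ! i = (c i 1 (edge M n i (Suc i) u), edge H n i (Suc i) b)" if i: "i < n" for i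
    proof (rule prod_eqI)
      show "snd (zs ! i) = snd (c i 1 (edge M n i (Suc i) u), edge H n i (Suc i) b)"
        using arg_cong[OF b(2), of "\<lambda>l. l ! i"] i zs(2) by simp
      have "zs ! i \<in> set zs" using i zs(2) by simp
      then have "fst (zs ! i) \<in> simplices M 1" using zs(1) by auto
      then obtain y where y: "y \<in> simplices M 1" "fst (zs ! i) = c i 1 y"
        using automorphism_bij[OF c[of i], of 1] i unfolding bij_betw_def by auto
      have g: "edge H n 0 i b \<in> simplices H 1" using b(1) i H_simplicial by simp
      \<comment> \<open>By the choice of \<open>u\<close>, this entry is the result of acting on
        \<open>c i 1 y\<close> by the edge of \<open>b\<close> from 0 to \<open>i\<close>; that
        action undoes \<open>c i\<close>, so the entry is \<open>y\<close>.\<close>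
      have "edge M n i (Suc i) u = sd_action conj_hom (pprod H (take i (spine H n b))) (fst (zs ! i))"
        using arg_cong[OF u(2), of "\<lambda>l. l ! i"] i zs(2) b(2) by (simp add: sd_twist_def)
      also have "\<dots> = conj_aut (edge H n 0 i b) 1 (c i 1 y)"
        using pprod_take_spine[OF H b(1), of i] i sd_action_conj_hom[OF g] y(2) by simp
      also have "\<dots> = y" using cc[of 0 i, OF _ _ y(1)] c0[OF y(1)] i by simp
      finally show "fst (zs ! i) = fst (c i 1 (edge M n i (Suc i) u), edge H n i (Suc i) b)"
        using y(2) by simp
    qed
    have "coord_list n (G n u (delta_id n)) = zs"
      by (rule main[OF G b(1) c Gj u(1) zs(2)]) (use nth in blast)+
    moreover have "G n u (delta_id n) \<in> simplices E n" by (rule cylinder_in[OF G u(1) delta_id_in])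
    ultimately show "zs \<in> coord_list n ` simplices E n" by blast
  qed
qed

section \<open>Existence and uniqueness of the splitting\<close>

definition splitting :: "(nat \<Rightarrow> 'c \<Rightarrow> (nat \<Rightarrow> 'a \<Rightarrow> 'a) list) \<Rightarrow> (nat \<Rightarrow> ('a \<times> 'c) list \<Rightarrow> 'b) \<Rightarrow> bool" where
  "splitting \<rho> \<phi> \<longleftrightarrow>
     sset_hom H (bar (aut_group M)) \<rho> \<and>
     sset_iso (semidirect M H \<rho>) E \<phi> \<and>
     sset_comp M \<phi> (sd_incl M H) = \<iota> \<and>
     sset_comp (semidirect M H \<rho>) \<tau> \<phi> = sd_proj M H \<rho> \<and>
     sset_comp H \<phi> (sd_sect M H) = \<sigma>"

text \<open>As \<open>\<phi>\<close> is inverse to \<open>coord_list\<close>, its compatibility with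
  inclusion and section amounts to computing the coordinates of \<open>\<iota> n u\<close> and
  \<open>\<sigma> n b\<close>. For the projection, the second coordinate is \<open>\<tau>\<close> by
  definition.\<close>

lemma splitting_exists:
  "splitting conj_hom (\<lambda>n. \<lambda>zs\<in>simplices (semidirect M H conj_hom) n. inv_into (simplices E n) (coord_list n) zs)"
    (is "splitting _ ?\<phi>")
proof -
  let ?S = "semidirect M H conj_hom"
  have list_in: "coord_list n e \<in> simplices ?S n" if "e \<in> simplices E n" for n e
    using bij_betw_apply[OF coord_list_bij that] .
  have \<phi>: "?\<phi> n (coord_list n e) = e" if "e \<in> simplices E n" for n e
    using bij_betw_inv_into_left[OF coord_list_bij that] list_in[OF that] by simp
  have "sset_iso ?S E ?\<phi>"
    using sset_iso_transport[OF E_simplicial coord_list_bij coord_list_sact] .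
  moreover have "sset_comp M ?\<phi> (sd_incl M H) = \<iota>"
  proof (rule ext, rule extensionalityI)
    fix n
    show "\<iota> n \<in> extensional (simplices M n)"
      using is_extension sset_iso_extensional unfolding extension_def by blast
    show "sset_comp M ?\<phi> (sd_incl M H) n \<in> extensional (simplices M n)"
      by (simp add: sset_comp_def compose_def)
    fix u assume u: "u \<in> simplices M n"
    have "coord_list n (\<iota> n u) = sd_incl M H n u"
    proof (rule nth_equalityI)
      fix i assume "i < length (coord_list n (\<iota> n u))"
      then have i: "i < n" by simp
      then have e: "edge M n i (Suc i) u \<in> simplices M 1" using u M_simplicial by simp
      have "coords (edge E n i (Suc i) (\<iota> n u)) = (edge M n i (Suc i) u, unit H)"
        using simplicial_map_edge[OF \<iota>_map _ _ u, of i "Suc i"] i glue_unit_right[OF e]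
          coords_glue[OF e unit_in[OF H]] by simp
      then show "coord_list n (\<iota> n u) ! i = sd_incl M H n u ! i"
        using i u by (simp add: coord_list_def sd_incl_def)
    qed (use u in \<open>simp add: sd_incl_def\<close>)
    then show "sset_comp M ?\<phi> (sd_incl M H) n u = \<iota> n u"
      using \<phi>[OF simplicial_map_in[OF \<iota>_map u]] u by (simp add: sset_comp_def compose_eq)
  qed
  moreover have "sset_comp ?S \<tau> ?\<phi> = sd_proj M H conj_hom"
  proof (rule ext, rule extensionalityI)
    fix n
    show "sset_comp ?S \<tau> ?\<phi> n \<in> extensional (simplices ?S n)"
      by (simp add: sset_comp_def compose_def)
    show "sd_proj M H conj_hom n \<in> extensional (simplices ?S n)"
      by (simp add: sd_proj_def)
    fix zs assume zs: "zs \<in> simplices ?S n"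
    then have "zs \<in> coord_list n ` simplices E n" using coord_list_bij unfolding bij_betw_def by blast
    then obtain e where e: "e \<in> simplices E n" "zs = coord_list n e" by blast
    have "map snd zs = spine H n (\<tau> n e)"
      using simplicial_map_edge[OF \<tau>_map _ _ e(1)] e(2)
      by (intro nth_equalityI) (auto simp: coord_list_def coords_def)
    then show "sset_comp ?S \<tau> ?\<phi> n zs = sd_proj M H conj_hom n zs"
      using \<phi>[OF e(1)] e(2) zs simplex_of_spine[OF H simplicial_map_in[OF \<tau>_map e(1)]]
      by (simp add: sset_comp_def compose_eq sd_proj_def)
  qed
  moreover have "sset_comp H ?\<phi> (sd_sect M H) = \<sigma>"
  proof (rule ext, rule extensionalityI)
    fix n
    show "\<sigma> n \<in> extensional (simplices H n)"
      using is_regular unfolding regular_section_def sset_hom_def by (auto simp: PiE_iff)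
    show "sset_comp H ?\<phi> (sd_sect M H) n \<in> extensional (simplices H n)"
      by (simp add: sset_comp_def compose_def)
    fix b assume b: "b \<in> simplices H n"
    have "coord_list n (\<sigma> n b) = sd_sect M H n b"
    proof (rule nth_equalityI)
      fix i assume "i < length (coord_list n (\<sigma> n b))"
      then have i: "i < n" by simp
      then have e: "edge H n i (Suc i) b \<in> simplices H 1" using b H_simplicial by simp
      have "coords (edge E n i (Suc i) (\<sigma> n b)) = (unit M, edge H n i (Suc i) b)"
        using simplicial_map_edge[OF \<sigma>_map _ _ b, of i "Suc i"] i glue_unit_left[OF e]
          coords_glue[OF unit_in[OF M] e] by simp
      then show "coord_list n (\<sigma> n b) ! i = sd_sect M H n b ! i"
        using i b by (simp add: coord_list_def sd_sect_def)
    qed (use b in \<open>simp add: sd_sect_def\<close>)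
    then show "sset_comp H ?\<phi> (sd_sect M H) n b = \<sigma> n b"
      using \<phi>[OF simplicial_map_in[OF \<sigma>_map b]] b by (simp add: sset_comp_def compose_eq)
  qed
  ultimately show ?thesis unfolding splitting_def using conj_hom_hom by blast
qed

text \<open>In \<open>M \<rtimes> H\<close> there are the simplices \<open>[(x, 1)|(1, g)]\<close> with product \<open>(x, g)\<close> and
  \<open>[(1, g)|(x, 1)]\<close> with product \<open>(\<^sup>gx, g)\<close>. The first determines \<open>\<phi>\<close> in degree 1 and the second
  determines the action.\<close>

lemma splitting_degree_1:
  assumes s: "splitting \<rho> \<phi>" and x: "x \<in> simplices M 1" and g: "g \<in> simplices H 1"
  shows "\<phi> 1 [(x, g)] = glue x g" and "\<rho> 1 g = [conj_aut g]"
proof -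
  let ?S = "semidirect M H \<rho>"
  have \<rho>: "sset_hom H (bar (aut_group M)) \<rho>" and \<phi>: "sset_iso ?S E \<phi>"
    and \<iota>\<phi>: "sset_comp M \<phi> (sd_incl M H) = \<iota>" and \<sigma>\<phi>: "sset_comp H \<phi> (sd_sect M H) = \<sigma>"
    using s unfolding splitting_def by blast+
  note \<rho>m = sset_hom_simplicial_map[OF \<rho>]
  have \<phi>m: "simplicial_map ?S E \<phi>" using \<phi> sset_hom_simplicial_map unfolding sset_iso_def by blast
  have act_in: "\<exists>c. \<rho> 1 h = [c] \<and> sset_iso M M c" if "h \<in> simplices H 1" for h
    using simplicial_map_in[OF \<rho>m that] by (auto simp: bar_def aut_group_def length_Suc_conv One_nat_def simp del: Suc_0_eq_1)
  \<comment> \<open>The bar construction has only the empty list in degree 0, and its degeneracy is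
    the list of the identity; so the unit of \<open>H\<close> acts trivially.\<close>
  have "\<rho> 0 (vertex H) = []" using simplicial_map_in[OF \<rho>m pm_vertex[OF H]] by (simp add: bar_def)
  then have "\<rho> 1 (unit H) = [sset_id M]"
    unfolding unit_def using simplicial_map_sact[OF \<rho>m _ pm_vertex[OF H], of "delta_const 1 0" 1]
    by (simp add: bar_def bar_act_def aut_group_def upt_rec)
  then have act_unit: "sd_action \<rho> (unit H) y = y" if "y \<in> simplices M 1" for y
    using that by (simp add: sd_action_def sset_id_def)
  have act_M: "sd_action \<rho> h y \<in> simplices M 1" if "h \<in> simplices H 1" "y \<in> simplices M 1" for h y
    using act_in[OF that(1)] that(2) simplicial_map_in[OF automorphism_map[OF automorphism_sset_iso]]
    by (auto simp: sd_action_def)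
  \<comment> \<open>The left unit law that removes the factor left over in
    \<open>bar_act_pair\<close>.\<close>
  have mul_e: "sd_mult M H \<rho> (unit M, unit H) (y, h) = (y, h)"
    if "y \<in> simplices M 1" "h \<in> simplices H 1" for y h
    using act_unit that unit_words[OF M] unit_words[OF H] by (simp add: sd_mult_def)
  note u = unit_in[OF M] unit_in[OF H]
  have edges: "edge E 2 0 1 (\<phi> 2 [a, b]) = \<phi> 1 [a]" "edge E 2 1 2 (\<phi> 2 [a, b]) = \<phi> 1 [b]"
    "edge E 2 0 2 (\<phi> 2 [a, b]) = \<phi> 1 [sd_mult M H \<rho> a b]" "\<phi> 2 [a, b] \<in> simplices E 2"
    if ab: "[a, b] \<in> simplices ?S 2" for a b
  proof -
    have "a \<in> simplices M 1 \<times> simplices H 1" "b \<in> simplices M 1 \<times> simplices H 1"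
      using ab by (auto simp: semidirect_def)
    then have "sd_mult M H \<rho> (unit M, unit H) a = a" "sd_mult M H \<rho> (unit M, unit H) b = b"
      using mul_e by (metis SigmaE)+
    then show "edge E 2 0 1 (\<phi> 2 [a, b]) = \<phi> 1 [a]" "edge E 2 1 2 (\<phi> 2 [a, b]) = \<phi> 1 [b]"
      "edge E 2 0 2 (\<phi> 2 [a, b]) = \<phi> 1 [sd_mult M H \<rho> a b]"
      using simplicial_map_edge[OF \<phi>m _ _ ab, of 0 1] simplicial_map_edge[OF \<phi>m _ _ ab, of 1 2]
        simplicial_map_edge[OF \<phi>m _ _ ab, of 0 2]
      by (simp_all add: semidirect_def bar_act_pair)
    show "\<phi> 2 [a, b] \<in> simplices E 2" using simplicial_map_in[OF \<phi>m ab] .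
  qed
  have \<phi>\<iota>: "\<phi> 1 [(y, unit H)] = \<iota> 1 y" if "y \<in> simplices M 1" for y
    using fun_cong[OF fun_cong[OF \<iota>\<phi>, of 1], of y] that M_simplicial
    by (simp add: sset_comp_def compose_eq sd_incl_def)
  have \<phi>\<sigma>: "\<phi> 1 [(unit M, h)] = \<sigma> 1 h" if "h \<in> simplices H 1" for h
    using fun_cong[OF fun_cong[OF \<sigma>\<phi>, of 1], of h] that H_simplicial
    by (simp add: sset_comp_def compose_eq sd_sect_def)
  have pair_in: "[(y, h), (y', h')] \<in> simplices ?S 2"
    if "y \<in> simplices M 1" "h \<in> simplices H 1" "y' \<in> simplices M 1" "h' \<in> simplices H 1"
      "[h, h'] \<in> words H 2" "[y, sd_action \<rho> h y'] \<in> words M 2" for y h y' h'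
  proof -
    have "sd_twist H \<rho> [(y, h), (y', h')] = [y, sd_action \<rho> h y']"
      using pprod_1[OF H that(2)] act_unit[OF that(1)]
      by (simp add: sd_twist_def upt_rec take_Cons')
    then show ?thesis using that by (simp add: semidirect_def)
  qed
  have \<phi>_glue: "\<phi> 1 [(y, g)] = glue y g" if y: "y \<in> simplices M 1" for y
  proof -
    have "[(y, unit H), (unit M, g)] \<in> simplices ?S 2"
      using pair_in[OF y u(2,1) g] act_unit[OF u(1)] unit_words[OF M y] unit_words[OF H g] by simp
    note w = edges[OF this]
    have "sd_mult M H \<rho> (y, unit H) (unit M, g) = (y, g)"
      using act_unit[OF u(1)] unit_words[OF M y] unit_words[OF H g] by (simp add: sd_mult_def)
    then show ?thesis using glue_eq[OF w(4)] w \<phi>\<iota>[OF y] \<phi>\<sigma>[OF g] by simp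
  qed
  show "\<phi> 1 [(x, g)] = glue x g" using \<phi>_glue[OF x] .
  obtain c where c: "\<rho> 1 g = [c]" "sset_iso M M c" using act_in[OF g] by blast
  have "c = conj_aut g"
  proof (rule sset_iso_eqI[OF M c(2) conj_aut_iso[OF g]])
    fix y assume y: "y \<in> simplices M 1"
    let ?y = "sd_action \<rho> g y"
    have y': "?y \<in> simplices M 1" using act_M[OF g y] .
    have "[(unit M, g), (y, unit H)] \<in> simplices ?S 2"
      using pair_in[OF u(1) g y u(2)] unit_words[OF M y'] unit_words[OF H g] by simp
    note w = edges[OF this]
    have "sd_mult M H \<rho> (unit M, g) (y, unit H) = (?y, g)"
      using unit_words[OF M y'] unit_words[OF H g] by (simp add: sd_mult_def)
    then have "conj_aut g 1 y = ?y"
      using conj_aut_unique[OF g y y' w(4)] w \<phi>\<iota>[OF y] \<phi>\<sigma>[OF g] \<phi>_glue[OF y'] by simp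
    then show "c 1 y = conj_aut g 1 y" by (simp add: sd_action_def c(1))
  qed
  then show "\<rho> 1 g = [conj_aut g]" using c(1) by simp
qed

text \<open>Degree 1 decides: a list in the bar construction consists of the values on its edges,
  and a map into the partial monoid \<open>E\<close> is determined on edges. Once the two actions
  agree, both isomorphisms have the same domain and can be compared.\<close>

lemma splitting_unique:
  assumes s: "splitting \<rho> \<phi>" and s': "splitting \<rho>' \<phi>'"
  shows "\<rho> = \<rho>'" "\<phi> = \<phi>'"
proof -
  have \<rho>_hom: "sset_hom H (bar (aut_group M)) \<rho>" and \<rho>'_hom: "sset_hom H (bar (aut_group M)) \<rho>'"
    using s s' unfolding splitting_def by blast+
  have mon: "monoid (aut_group M)" by (rule aut_group_monoid[OF M_simplicial])
  show \<rho>: "\<rho> = \<rho>'"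
  proof (rule ext, rule extensionalityI)
    fix n
    show "\<rho> n \<in> extensional (simplices H n)" "\<rho>' n \<in> extensional (simplices H n)"
      using \<rho>_hom \<rho>'_hom unfolding sset_hom_def by (auto simp: PiE_iff)
    fix b assume b: "b \<in> simplices H n"
    note \<rho>b = simplicial_map_in[OF sset_hom_simplicial_map[OF \<rho>_hom] b]
    note \<rho>'b = simplicial_map_in[OF sset_hom_simplicial_map[OF \<rho>'_hom] b]
    show "\<rho> n b = \<rho>' n b"
    proof (rule nth_equalityI)
      show "length (\<rho> n b) = length (\<rho>' n b)" using \<rho>b \<rho>'b by (simp add: bar_def)
      fix i assume "i < length (\<rho> n b)"
      then have i: "i < n" using \<rho>b by (simp add: bar_def)
      then have e: "edge H n i (Suc i) b \<in> simplices H 1" using b H_simplicial by simp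
      have "[\<rho> n b ! i] = \<rho> 1 (edge H n i (Suc i) b)"
        using bar_nth[OF mon \<rho>b i] simplicial_map_edge[OF sset_hom_simplicial_map[OF \<rho>_hom] _ _ b] i by simp
      also have "\<dots> = \<rho>' 1 (edge H n i (Suc i) b)"
        \<comment> \<open>The degree 1 statement asks for some 1-simplex of \<open>M\<close>; the
          unit serves.\<close>
        using splitting_degree_1(2)[OF s unit_in[OF M] e] splitting_degree_1(2)[OF s' unit_in[OF M] e] by simp
      also have "\<dots> = [\<rho>' n b ! i]"
        using bar_nth[OF mon \<rho>'b i] simplicial_map_edge[OF sset_hom_simplicial_map[OF \<rho>'_hom] _ _ b] i by simp
      finally show "\<rho> n b ! i = \<rho>' n b ! i" by simp
    qed
  qed
  show "\<phi> = \<phi>'"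
  proof (rule sset_iso_eqI[OF E_monoid])
    show "sset_iso (semidirect M H \<rho>) E \<phi>" "sset_iso (semidirect M H \<rho>) E \<phi>'"
      using s s' unfolding splitting_def \<rho> by blast+
    fix zs assume "zs \<in> simplices (semidirect M H \<rho>) 1"
    then obtain x g where "zs = [(x, g)]" "x \<in> simplices M 1" "g \<in> simplices H 1"
      by (auto simp: semidirect_def length_Suc_conv One_nat_def simp del: Suc_0_eq_1)
    then show "\<phi> 1 zs = \<phi>' 1 zs"
      using splitting_degree_1(1)[OF s] splitting_degree_1(1)[OF s'] by simp
  qed
qed

end

text \<open>That the section determines the homomorphism and the isomorphism is expressed by unique
  existence of the pair.\<close>

theorem lemma5p3:
  fixes M :: "'a sset" and E :: "'b sset" and H :: "'c sset"
    and \<iota> :: "nat \<Rightarrow> 'a \<Rightarrow> 'b" and \<tau> :: "nat \<Rightarrow> 'b \<Rightarrow> 'c" and \<sigma> :: "nat \<Rightarrow> 'c \<Rightarrow> 'b"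
  assumes "extension M E H \<iota> \<tau>"
    and "regular_section M E H \<iota> \<tau> \<sigma>"
  shows "\<exists>!p. case p of (\<rho>, \<phi>) \<Rightarrow>
           sset_hom H (bar (aut_group M)) \<rho> \<and>
           sset_iso (semidirect M H \<rho>) E \<phi> \<and>
           sset_comp M \<phi> (sd_incl M H) = \<iota> \<and>
           sset_comp (semidirect M H \<rho>) \<tau> \<phi> = sd_proj M H \<rho> \<and>
           sset_comp H \<phi> (sd_sect M H) = \<sigma>"
proof -
  interpret regular_split M E H \<iota> \<tau> \<sigma> using assms by unfold_locales
  obtain \<rho> \<phi> where s: "splitting \<rho> \<phi>" using splitting_exists by blast
  have "\<exists>!p. case p of (\<rho>, \<phi>) \<Rightarrow> splitting \<rho> \<phi>"
  proof (rule ex1I[of _ "(\<rho>, \<phi>)"])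
    show "case (\<rho>, \<phi>) of (\<rho>, \<phi>) \<Rightarrow> splitting \<rho> \<phi>" using s by simp
    fix p assume "case p of (\<rho>, \<phi>) \<Rightarrow> splitting \<rho> \<phi>"
    then show "p = (\<rho>, \<phi>)" using splitting_unique[OF _ s] by (cases p) auto
  qed
  then show ?thesis unfolding splitting_def .
qed

end
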